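(* Let $(M_1,\dots,M_p,Y)$ be a centered process with finite variance on $D\subset\mathbb{R}^d$, with $K_M(x)=\mathrm{Cov}[M(x),M(x)]$ invertible for all $x\in D$, where $M(x)=(M_1(x),\dots,M_p(x))^t$. Let $X$ be the matrix of observation points $x_1,\dots,x_n\in D$, and let $Y_{\mathcal{A}}$ be the aggregated process, with covariance function $k_{\mathcal{A}}$ (see context). Define, for $x,x'\in D$, $$c_{\mathcal{A}}(x,x')=\mathrm{Cov}\big[Y_{\mathcal{A}}(x),Y_{\mathcal{A}}(x')\mid Y_{\mathcal{A}}(X)\big].$$ Assume that $(M_1,\dots,M_p,Y)$ is a (multivariate) Gaussian process. Then $Y_{\mathcal{A}}$ is also Gaussian and the following hold. (i) For all $x,x'\in D$, $c_{\mathcal{A}}(x,x')=k_{\mathcal{A}}(x,x')-k_{\mathcal{A}}(x,X)k_{\mathcal{A}}(X,X)^{-1}k_{\mathcal{A}}(X,x')$. Assume in addition: (linearity) for all $x\in D$ there is a deterministic $p\times n$ matrix $\Lambda(x)$ with $M(x)=\Lambda(x)Y(X)$; and (interpolation) for every observation point $x_k$ there is at least one index $i_k\in\{1,\dots,p\}$ with $M_{i_k}(x_k)=Y(x_k)$. Then: (ii) with $\alpha_{\mathcal{A}}(x)=K_M(x)^{-1}k_M(x)$, for all $x,x'\in D$, $$c_{\mathcal{A}}(x,x')=k(x,x')-\alpha_{\mathcal{A}}(x)^tk_M(x,x')-k_M(x',x)^t\alpha_{\mathcal{A}}(x')+\alpha_{\mathcal{A}}(x)^tK_M(x,x')\alpha_{\mathcal{A}}(x');$$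 (iii) for all $x,x'\in D$, $$c_{\mathcal{A}}(x,x')=\mathrm{E}\big[(Y(x)-M_{\mathcal{A}}(x))(Y(x')-M_{\mathcal{A}}(x'))\big].$$
   Context: $k(x,x')=\mathrm{Cov}[Y(x),Y(x')]$; $k_M(x,x')=\mathrm{Cov}[M(x),Y(x')]$ ($p\times1$ vector); $K_M(x,x')=\mathrm{Cov}[M(x),M(x')]$ ($p\times p$ matrix); $k_M(x)=k_M(x,x)$ and $K_M(x)=K_M(x,x)$. For a function $g$ of two variables, $g(X,X)$ is the $n\times n$ matrix with entries $g(x_i,x_j)$, $g(x,X)$ the row vector with entries $g(x,x_j)$, and $g(X,x)$ the column vector with entries $g(x_i,x)$; $Y(X)=(Y(x_1),\dots,Y(x_n))^t$. The nested Kriging predictor is $M_{\mathcal{A}}(x)=k_M(x)^tK_M(x)^{-1}M(x)$. The aggregated process is $Y_{\mathcal{A}}=M_{\mathcal{A}}+\varepsilon'_{\mathcal{A}}$, where $\varepsilon'_{\mathcal{A}}$ is an independent replicate of $Y-M_{\mathcal{A}}$ (a process with the same distribution as $Y-M_{\mathcal{A}}$, independent of $(M_1,\dots,M_p,Y)$), and $k_{\mathcal{A}}(x,x')=\mathrm{Cov}[Y_{\mathcal{A}}(x),Y_{\mathcal{A}}(x')]$. The matrices $k(X,X)$ and $k_{\mathcal{A}}(X,X)$ are assumed invertible. *)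

theory Defs
  imports "HOL-Probability.Probability"
begin

text \<open>A process over an index set \<open>I\<close> on the probability space \<open>P\<close> is a family \<open>Z i \<omega>\<close>;
  only the indices \<open>i \<in> I\<close> are relevant.\<close>

definition path :: "'i set \<Rightarrow> ('i \<Rightarrow> 'w \<Rightarrow> real) \<Rightarrow> 'w \<Rightarrow> 'i \<Rightarrow> real" where
  "path I Z \<omega> = (\<lambda>i\<in>I. Z i \<omega>)"

definition generated_sigma :: "'w measure \<Rightarrow> 'i set \<Rightarrow> ('i \<Rightarrow> 'w \<Rightarrow> real) \<Rightarrow> 'w measure" where
  "generated_sigma P I Z = vimage_algebra (space P) (path I Z) (PiM I (\<lambda>_. borel))"

definition centered_square_integrable ::
    "'w measure \<Rightarrow> 'i set \<Rightarrow> ('i \<Rightarrow> 'w \<Rightarrow> real) \<Rightarrow> bool" where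
  "centered_square_integrable P I Z \<longleftrightarrow>
     (\<forall>i\<in>I. Z i \<in> borel_measurable P \<and> integrable P (\<lambda>\<omega>. (Z i \<omega>)\<^sup>2) \<and>
        integral\<^sup>L P (Z i) = 0)"

text \<open>Degenerate (almost surely constant) variables count as Gaussian; linear combinations of the
  components of a Gaussian process may well vanish.\<close>

definition gaussian_rv :: "'w measure \<Rightarrow> ('w \<Rightarrow> real) \<Rightarrow> bool" where
  "gaussian_rv P U \<longleftrightarrow> U \<in> borel_measurable P \<and>
     (\<exists>\<mu>. (AE \<omega> in P. U \<omega> = \<mu>) \<or>
          (\<exists>\<sigma>>0. distributed P lborel U (normal_density \<mu> \<sigma>)))"

definition gaussian_process :: "'w measure \<Rightarrow> 'i set \<Rightarrow> ('i \<Rightarrow> 'w \<Rightarrow> real) \<Rightarrow> bool" where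
  "gaussian_process P I Z \<longleftrightarrow>
     (\<forall>S a. finite S \<and> S \<subseteq> I \<longrightarrow> gaussian_rv P (\<lambda>\<omega>. \<Sum>i\<in>S. a i * Z i \<omega>))"

definition covariance :: "'w measure \<Rightarrow> ('w \<Rightarrow> real) \<Rightarrow> ('w \<Rightarrow> real) \<Rightarrow> real" where
  "covariance P U V =
     integral\<^sup>L P (\<lambda>\<omega>. (U \<omega> - integral\<^sup>L P U) * (V \<omega> - integral\<^sup>L P V))"

text \<open>Conditional covariance given a sub-\<open>\<sigma>\<close>-algebra: a random variable, determined almost surely.\<close>

definition cond_covariance ::
    "'w measure \<Rightarrow> 'w measure \<Rightarrow> ('w \<Rightarrow> real) \<Rightarrow> ('w \<Rightarrow> real) \<Rightarrow> 'w \<Rightarrow> real" where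
  "cond_covariance P F U V =
     real_cond_exp P F
       (\<lambda>\<omega>. (U \<omega> - real_cond_exp P F U \<omega>) * (V \<omega> - real_cond_exp P F V \<omega>))"

text \<open>The process \<open>(M\<^sub>1, \<dots>, M\<^sub>p, Y)\<close> as one real-valued family: component \<open>Some i\<close> is \<open>M\<^sub>i\<close> and
  component \<open>None\<close> is \<open>Y\<close>.\<close>

definition joint_process ::
    "('x \<Rightarrow> 'w \<Rightarrow> real^'p) \<Rightarrow> ('x \<Rightarrow> 'w \<Rightarrow> real) \<Rightarrow> 'x \<times> 'p option \<Rightarrow> 'w \<Rightarrow> real" where
  "joint_process M Y = (\<lambda>(x, c) \<omega>. case c of None \<Rightarrow> Y x \<omega> | Some i \<Rightarrow> M x \<omega> $ i)"

definition cov_fun :: "'w measure \<Rightarrow> ('x \<Rightarrow> 'w \<Rightarrow> real) \<Rightarrow> 'x \<Rightarrow> 'x \<Rightarrow> real" where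
  "cov_fun P Y x x' = covariance P (Y x) (Y x')"

definition cross_cov ::
    "'w measure \<Rightarrow> ('x \<Rightarrow> 'w \<Rightarrow> real^'p) \<Rightarrow> ('x \<Rightarrow> 'w \<Rightarrow> real) \<Rightarrow> 'x \<Rightarrow> 'x \<Rightarrow> real^'p" where
  "cross_cov P M Y x x' = (\<chi> i. covariance P (\<lambda>\<omega>. M x \<omega> $ i) (Y x'))"

definition cov_matrix ::
    "'w measure \<Rightarrow> ('x \<Rightarrow> 'w \<Rightarrow> real^'p) \<Rightarrow> 'x \<Rightarrow> 'x \<Rightarrow> real^'p^'p" where
  "cov_matrix P M x x' = (\<chi> i j. covariance P (\<lambda>\<omega>. M x \<omega> $ i) (\<lambda>\<omega>. M x' \<omega> $ j))"

text \<open>Evaluation of a two-variable function at the observation points, the rows of \<open>X\<close>.\<close>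

definition gram :: "('x \<Rightarrow> 'x \<Rightarrow> real) \<Rightarrow> 'x^'n \<Rightarrow> real^'n^'n" where
  "gram g X = (\<chi> i j. g (X $ i) (X $ j))"

definition row_at :: "('x \<Rightarrow> 'x \<Rightarrow> real) \<Rightarrow> 'x \<Rightarrow> 'x^'n \<Rightarrow> real^'n" where
  "row_at g x X = (\<chi> j. g x (X $ j))"

definition col_at :: "('x \<Rightarrow> 'x \<Rightarrow> real) \<Rightarrow> 'x^'n \<Rightarrow> 'x \<Rightarrow> real^'n" where
  "col_at g X x = (\<chi> i. g (X $ i) x)"

definition obs :: "('x \<Rightarrow> 'w \<Rightarrow> real) \<Rightarrow> 'x^'n \<Rightarrow> 'w \<Rightarrow> real^'n" where
  "obs Y X \<omega> = (\<chi> i. Y (X $ i) \<omega>)"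

definition nested_kriging ::
    "'w measure \<Rightarrow> ('x \<Rightarrow> 'w \<Rightarrow> real^'p) \<Rightarrow> ('x \<Rightarrow> 'w \<Rightarrow> real) \<Rightarrow> 'x \<Rightarrow> 'w \<Rightarrow> real" where
  "nested_kriging P M Y x \<omega> =
     cross_cov P M Y x x \<bullet> (matrix_inv (cov_matrix P M x x) *v M x \<omega>)"

text \<open>\<open>E\<close> has the same law as \<open>R\<close> as a process over \<open>D\<close> and is independent, as a process, of the
  process \<open>Z\<close> over \<open>I\<close>.  Independence is stated for generated \<open>\<sigma>\<close>-algebras since \<open>indep_var\<close> requires
  both variables to have the same value type.\<close>

definition independent_replicate ::
    "'w measure \<Rightarrow> 'x set \<Rightarrow> ('x \<Rightarrow> 'w \<Rightarrow> real) \<Rightarrow> ('x \<Rightarrow> 'w \<Rightarrow> real) \<Rightarrow>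
     'i set \<Rightarrow> ('i \<Rightarrow> 'w \<Rightarrow> real) \<Rightarrow> bool" where
  "independent_replicate P D E R I Z \<longleftrightarrow>
     (\<forall>x\<in>D. E x \<in> borel_measurable P) \<and>
     distr P (PiM D (\<lambda>_. borel)) (path D E) = distr P (PiM D (\<lambda>_. borel)) (path D R) \<and>
     prob_space.indep_set P (sets (generated_sigma P D E)) (sets (generated_sigma P I Z))"

definition aggregated ::
    "'w measure \<Rightarrow> ('x \<Rightarrow> 'w \<Rightarrow> real^'p) \<Rightarrow> ('x \<Rightarrow> 'w \<Rightarrow> real) \<Rightarrow> ('x \<Rightarrow> 'w \<Rightarrow> real) \<Rightarrow>
     'x \<Rightarrow> 'w \<Rightarrow> real" where
  "aggregated P M Y E x \<omega> = nested_kriging P M Y x \<omega> + E x \<omega>"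

definition cond_cov_fun ::
    "'w measure \<Rightarrow> ('x \<Rightarrow> 'w \<Rightarrow> real) \<Rightarrow> 'x^'n \<Rightarrow> 'x \<Rightarrow> 'x \<Rightarrow> 'w \<Rightarrow> real" where
  "cond_cov_fun P Z X x x' =
     cond_covariance P (generated_sigma P UNIV (\<lambda>j. Z (X $ j))) (Z x) (Z x')"

definition agg_weights ::
    "'w measure \<Rightarrow> ('x \<Rightarrow> 'w \<Rightarrow> real^'p) \<Rightarrow> ('x \<Rightarrow> 'w \<Rightarrow> real) \<Rightarrow> 'x \<Rightarrow> real^'p" where
  "agg_weights P M Y x = matrix_inv (cov_matrix P M x x) *v cross_cov P M Y x x"

end

theory Submission
  imports Defs
begin

text \<open>For a jointly Gaussian centered family, the residual of the linear regression on finitely many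
  observations is uncorrelated with them, hence independent of the \<open>\<sigma>\<close>-algebra they generate; so the
  conditional covariance is the deterministic covariance of the residuals, which gives (i). The
  passage from uncorrelated to independent goes through characteristic functions: Levy uniqueness,
  applied to the positive and negative parts of a density and one coordinate at a time, shows that
  \<open>E (h exp (i t \<bullet> W)) = 0\<close> for all \<open>t\<close> forces \<open>E (h 1\<^sub>B(W)) = 0\<close> for all boxes \<open>B\<close>.

  Under linearity and interpolation, \<open>M\<^sub>A = Y\<close> and hence \<open>\<epsilon> = 0\<close> almost surely at the observation
  points, so the regression term in (i) is exactly the covariance of \<open>M\<^sub>A(x)\<close> and \<open>M\<^sub>A(x')\<close>. Since
  \<open>k\<^sub>A(x, x')\<close> is this covariance plus that of the errors \<open>Y - M\<^sub>A\<close>, only the latter remains.\<close>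

section \<open>Uniqueness for characteristic functions\<close>

context prob_space begin

text \<open>The positive and negative parts of \<open>f\<close>, once normalised, are densities
  under which \<open>W\<close> has the same characteristic function. Levy uniqueness makes the two
  laws of \<open>W\<close> equal, so both parts give the same mass to
  \<open>W \<in> B\<close>.\<close>

lemma integral_indicator_eq_0_real:
  fixes f W :: "'a \<Rightarrow> real"
  assumes f: "integrable M f" and W[measurable]: "W \<in> borel_measurable M"
    and zero: "\<And>t. (CLINT \<omega>|M. f \<omega> * iexp (t * W \<omega>)) = 0"
    and B[measurable]: "B \<in> sets borel"
  shows "(\<integral>\<omega>. f \<omega> * indicator B (W \<omega>) \<partial>M) = 0"
proof -
  have f_meas[measurable]: "f \<in> borel_measurable M"
    using f by auto
  define p q where "p \<omega> = max 0 (f \<omega>)" and "q \<omega> = max 0 (- f \<omega>)" for \<omega>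
  have f_eq: "f \<omega> = p \<omega> - q \<omega>" for \<omega>
    by (auto simp: p_def q_def)
  have pq: "integrable M p" "integrable M q" "\<And>\<omega>. 0 \<le> p \<omega>" "\<And>\<omega>. 0 \<le> q \<omega>"
    using f by (auto simp: p_def[abs_def] q_def[abs_def])
  have [measurable]: "p \<in> borel_measurable M" "q \<in> borel_measurable M"
    using pq by auto
  have int_iexp: "integrable M (\<lambda>\<omega>. g \<omega> * iexp (t * W \<omega>))"
    if "integrable M g" for g :: "'a \<Rightarrow> real" and t
    by (rule Bochner_Integration.integrable_bound[OF that]) (use that in \<open>auto simp: norm_mult\<close>)
  have int_ind: "integrable M (\<lambda>\<omega>. g \<omega> * indicator B (W \<omega>))"
    if "integrable M g" for g :: "'a \<Rightarrow> real"
    by (rule Bochner_Integration.integrable_bound[OF that])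
       (use that in \<open>auto simp: indicator_def\<close>)
  define c where "c = (\<integral>\<omega>. p \<omega> \<partial>M)"
  \<comment> \<open>At \<open>t = 0\<close> the hypothesis says that \<open>f\<close> has integral
    zero, so \<open>p\<close> and \<open>q\<close> have the same mass \<open>c\<close>.\<close>
  have "complex_of_real (\<integral>\<omega>. f \<omega> \<partial>M) = 0"
    using zero[of 0] by simp
  then have q_c: "(\<integral>\<omega>. q \<omega> \<partial>M) = c"
    using pq unfolding f_eq c_def by simp
  show ?thesis
  \<comment> \<open>Mass zero cannot be normalised, but then both parts, and with them
    \<open>f\<close>, vanish almost everywhere.\<close>
  proof (cases "c = 0")
    case True
    then have "AE \<omega> in M. p \<omega> = 0" "AE \<omega> in M. q \<omega> = 0"
      using pq q_c integral_nonneg_eq_0_iff_AE[of M p] integral_nonneg_eq_0_iff_AE[of M q]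
      by (simp_all add: c_def)
    then have "AE \<omega> in M. f \<omega> * indicator B (W \<omega>) = 0"
      by eventually_elim (simp add: f_eq)
    then show ?thesis
      by (simp add: integral_eq_zero_AE)
  next
    case False
    have "0 \<le> c"
      unfolding c_def using pq by simp
    with False have c: "0 < c" by simp
    \<comment> \<open>Dividing by the common mass turns \<open>p\<close> and \<open>q\<close> into
      probability densities; \<open>law g\<close> is the law of \<open>W\<close> under such a change
      of measure.\<close>
    define law where "law g = distr (density M (\<lambda>\<omega>. ennreal (g \<omega> / c))) borel W" for g
    have law: "real_distribution (law g)"
        "char (law g) t = (CLINT \<omega>|M. g \<omega> * iexp (t * W \<omega>)) / c"
        "measure (law g) B = (\<integral>\<omega>. g \<omega> * indicator B (W \<omega>) \<partial>M) / c"
      if g: "integrable M g" "\<And>\<omega>. 0 \<le> g \<omega>" "(\<integral>\<omega>. g \<omega> \<partial>M) = c" for g t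
    proof -
      have [measurable]: "g \<in> borel_measurable M" using g by auto
      have "prob_space (density M (\<lambda>\<omega>. ennreal (g \<omega> / c)))"
      proof
        have "(\<integral>\<^sup>+\<omega>. ennreal (g \<omega> / c) \<partial>M) = ennreal (\<integral>\<omega>. g \<omega> / c \<partial>M)"
          using g c by (intro nn_integral_eq_integral) auto
        also have "\<dots> = 1"
          using g c by simp
        finally show "emeasure (density M (\<lambda>\<omega>. ennreal (g \<omega> / c)))
            (space (density M (\<lambda>\<omega>. ennreal (g \<omega> / c)))) = 1"
          by (simp add: emeasure_density cong: nn_integral_cong)
      qed
      then show *: "real_distribution (law g)"
        unfolding law_def by (rule prob_space.real_distribution_distr) simp
      have "char (law g) t = (CLINT \<omega>|M. (g \<omega> / c) *\<^sub>R iexp (t * W \<omega>))"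
        unfolding law_def char_def using g c
        by (simp add: integral_distr integral_density)
      also have "\<dots> = (CLINT \<omega>|M. (1 / c) *\<^sub>R (g \<omega> * iexp (t * W \<omega>)))"
        by (simp add: scaleR_conv_of_real)
      finally show "char (law g) t = (CLINT \<omega>|M. g \<omega> * iexp (t * W \<omega>)) / c"
        by (simp add: scaleR_conv_of_real)
      interpret law: real_distribution "law g" by fact
      have "measure (law g) B = (\<integral>x. indicator B x \<partial>law g)"
        by simp
      also have "\<dots> = (\<integral>\<omega>. (g \<omega> / c) *\<^sub>R indicator B (W \<omega>) \<partial>M)"
        unfolding law_def using g c
        by (subst integral_distr) (auto simp: integral_density)
      finally show "measure (law g) B = (\<integral>\<omega>. g \<omega> * indicator B (W \<omega>) \<partial>M) / c"
        by simp
    qed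
    have "law p = law q"
    proof (rule Levy_uniqueness)
      show "char (law p) = char (law q)"
      proof
        fix t
        have "(CLINT \<omega>|M. p \<omega> * iexp (t * W \<omega>)) - (CLINT \<omega>|M. q \<omega> * iexp (t * W \<omega>)) = 0"
          using zero[of t] unfolding f_eq Bochner_Integration.integral_diff[OF int_iexp int_iexp, OF pq(1,2), symmetric]
          by (simp add: algebra_simps)
        then show "char (law p) t = char (law q) t"
          using pq q_c by (simp add: law c_def[symmetric])
      qed
    qed (use law pq q_c c_def in auto)
    then have "(\<integral>\<omega>. p \<omega> * indicator B (W \<omega>) \<partial>M) = (\<integral>\<omega>. q \<omega> * indicator B (W \<omega>) \<partial>M)"
      using law(3)[of p] law(3)[of q] pq q_c c by (simp add: c_def[symmetric])
    then show ?thesis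
      unfolding f_eq left_diff_distrib using pq by (simp add: int_ind)
  qed
qed

text \<open>Complex weights arise when the coordinates are treated one by one, since the weight then
  carries factors \<open>iexp\<close>. Real and imaginary parts are combinations of \<open>h\<close>
  and its conjugate, so it suffices that the conjugate satisfies the hypothesis as well.\<close>

lemma integral_indicator_eq_0:
  fixes h :: "'a \<Rightarrow> complex" and W :: "'a \<Rightarrow> real"
  assumes h: "integrable M h" and W[measurable]: "W \<in> borel_measurable M"
    and zero: "\<And>t. (CLINT \<omega>|M. h \<omega> * iexp (t * W \<omega>)) = 0"
    and B[measurable]: "B \<in> sets borel"
  shows "(CLINT \<omega>|M. h \<omega> * indicator B (W \<omega>)) = 0"
proof -
  have h_meas[measurable]: "h \<in> borel_measurable M" using h by auto
  have [measurable]: "(\<lambda>\<omega>. cnj (h \<omega>)) \<in> borel_measurable M"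
    using integrable_cnj[OF h] by (rule borel_measurable_integrable)
  have int1: "integrable M (\<lambda>\<omega>. h \<omega> * iexp (t * W \<omega>))" for t
    by (rule Bochner_Integration.integrable_bound[OF h]) (auto simp: norm_mult)
  have int2: "integrable M (\<lambda>\<omega>. cnj (h \<omega>) * iexp (t * W \<omega>))" for t
    by (rule Bochner_Integration.integrable_bound[OF h]) (auto simp: norm_mult)
  have int3: "integrable M (\<lambda>\<omega>. h \<omega> * indicator B (W \<omega>))"
    by (rule Bochner_Integration.integrable_bound[OF h]) (auto simp: norm_mult indicator_def)
  \<comment> \<open>Conjugation sends the frequency \<open>t\<close> to \<open>- t\<close>, and the
    hypothesis holds at all frequencies.\<close>
  have zero': "(CLINT \<omega>|M. cnj (h \<omega>) * iexp (t * W \<omega>)) = 0" for t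
  proof -
    have "(CLINT \<omega>|M. cnj (h \<omega>) * iexp (t * W \<omega>)) = (CLINT \<omega>|M. cnj (h \<omega> * iexp ((- t) * W \<omega>)))"
      by (simp add: exp_cnj)
    also have "\<dots> = 0"
      by (subst Bochner_Integration.integral_cnj) (use zero[of "-t"] in simp)
    finally show ?thesis .
  qed
  have Re: "complex_of_real (Re z) = (z + cnj z) / 2" and Im: "complex_of_real (Im z) = (z - cnj z) / (2 * \<i>)" for z
    by (auto simp: complex_eq_iff)
  have "(\<integral>\<omega>. Re (h \<omega>) * indicator B (W \<omega>) \<partial>M) = 0"
  proof (rule integral_indicator_eq_0_real)
    fix t
    have "(CLINT \<omega>|M. Re (h \<omega>) * iexp (t * W \<omega>)) =
      (CLINT \<omega>|M. (h \<omega> * iexp (t * W \<omega>) + cnj (h \<omega>) * iexp (t * W \<omega>)) / 2)"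
      by (simp add: Re field_simps)
    also have "\<dots> = 0"
      using int1[of t] int2[of t] zero[of t] zero'[of t] by simp
    finally show "(CLINT \<omega>|M. Re (h \<omega>) * iexp (t * W \<omega>)) = 0" .
  qed (use h in auto)
  moreover have "(\<integral>\<omega>. Im (h \<omega>) * indicator B (W \<omega>) \<partial>M) = 0"
  proof (rule integral_indicator_eq_0_real)
    fix t
    have "(CLINT \<omega>|M. Im (h \<omega>) * iexp (t * W \<omega>)) =
      (CLINT \<omega>|M. (h \<omega> * iexp (t * W \<omega>) - cnj (h \<omega>) * iexp (t * W \<omega>)) / (2 * \<i>))"
      by (simp add: Im field_simps)
    also have "\<dots> = 0"
      using int1[of t] int2[of t] zero[of t] zero'[of t] by simp
    finally show "(CLINT \<omega>|M. Im (h \<omega>) * iexp (t * W \<omega>)) = 0" .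
  qed (use h in auto)
  moreover have "Re (h \<omega> * indicator B (W \<omega>)) = Re (h \<omega>) * indicator B (W \<omega>)"
      "Im (h \<omega> * indicator B (W \<omega>)) = Im (h \<omega>) * indicator B (W \<omega>)" for \<omega>
    by (auto simp: indicator_def)
  ultimately show ?thesis
    using int3 by (simp add: complex_eq_iff flip: integral_Re integral_Im)
qed

text \<open>Induction on the coordinates, each step trading one exponential for one indicator. The
  weight \<open>h\<close> is generalised because the induction hypothesis is applied to
  \<open>h\<close> times the exponential of the coordinate still to be treated.\<close>

lemma integral_prod_indicator_eq_0:
  fixes h :: "'a \<Rightarrow> complex" and W :: "'j \<Rightarrow> 'a \<Rightarrow> real"
  assumes "finite J" "integrable M h" and [measurable]: "\<And>j. W j \<in> borel_measurable M"
    and "\<And>t. (CLINT \<omega>|M. h \<omega> * iexp (\<Sum>j\<in>J. t j * W j \<omega>)) = 0"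
    and [measurable]: "\<And>j. B j \<in> sets borel"
  shows "(CLINT \<omega>|M. h \<omega> * (\<Prod>j\<in>J. indicator (B j) (W j \<omega>))) = 0"
  using assms(1,2,4)
proof (induction J arbitrary: h rule: finite_induct)
  case empty
  then show ?case by simp
next
  case (insert i J)
  note h = \<open>integrable M h\<close>
  have [measurable]: "h \<in> borel_measurable M" using h by auto
  have "(CLINT \<omega>|M. (h \<omega> * (\<Prod>j\<in>J. indicator (B j) (W j \<omega>))) * indicator (B i) (W i \<omega>)) = 0"
  proof (rule integral_indicator_eq_0)
    show "integrable M (\<lambda>\<omega>. h \<omega> * (\<Prod>j\<in>J. indicator (B j) (W j \<omega>)))"
      by (rule Bochner_Integration.integrable_bound[OF h])
         (auto simp: norm_mult prod_norm[symmetric] indicator_def intro!: mult_left_le prod_le_1)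
    fix s
    have "(CLINT \<omega>|M. (h \<omega> * iexp (s * W i \<omega>)) * (\<Prod>j\<in>J. indicator (B j) (W j \<omega>))) = 0"
    proof (rule insert.IH)
      show "integrable M (\<lambda>\<omega>. h \<omega> * iexp (s * W i \<omega>))"
        by (rule Bochner_Integration.integrable_bound[OF h]) (auto simp: norm_mult)
      fix t
      \<comment> \<open>The frequency vector is overwritten with \<open>s\<close> at
        \<open>i\<close>; since \<open>i \<notin> J\<close>, the sum over \<open>J\<close> keeps its
        value.\<close>
      have "(\<Sum>j\<in>insert i J. (t(i := s)) j * W j \<omega>) = s * W i \<omega> + (\<Sum>j\<in>J. t j * W j \<omega>)" for \<omega>
        using insert.hyps by (auto intro!: sum.cong)
      then have "iexp (\<Sum>j\<in>insert i J. (t(i := s)) j * W j \<omega>) = iexp (s * W i \<omega>) * iexp (\<Sum>j\<in>J. t j * W j \<omega>)" for \<omega>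
        by (simp add: exp_add[symmetric] distrib_left)
      then show "(CLINT \<omega>|M. h \<omega> * iexp (s * W i \<omega>) * iexp (\<Sum>j\<in>J. t j * W j \<omega>)) = 0"
        using insert.prems(2)[of "t(i := s)"] by (simp add: mult.assoc)
    qed
    then show "(CLINT \<omega>|M. h \<omega> * (\<Prod>j\<in>J. indicator (B j) (W j \<omega>)) * iexp (s * W i \<omega>)) = 0"
      by (simp add: mult_ac)
  qed auto
  then show ?case
    using insert.hyps by (simp add: mult_ac)
qed


text \<open>A factorising joint characteristic function gives independence: the uniqueness results
  are used once to pass from exponentials of \<open>W\<close> to boxes and once to pass from
  exponentials of \<open>R\<close> to Borel sets. Product rules on these intersection-stable
  families then extend to the generated sigma-algebras.\<close>

lemma indep_set_char_factor:
  fixes R :: "'a \<Rightarrow> real" and W :: "'n::finite \<Rightarrow> 'a \<Rightarrow> real"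
  assumes [measurable]: "R \<in> borel_measurable M" "\<And>j. W j \<in> borel_measurable M"
    and factor: "\<And>s t. (CLINT \<omega>|M. iexp (s * R \<omega> + (\<Sum>j\<in>UNIV. t j * W j \<omega>))) =
      (CLINT \<omega>|M. iexp (s * R \<omega>)) * (CLINT \<omega>|M. iexp (\<Sum>j\<in>UNIV. t j * W j \<omega>))"
  shows "indep_set (sets (vimage_algebra (space M) R borel))
    (sets (generated_sigma M UNIV W))"
proof -
  define box where "box B = {\<omega> \<in> space M. \<forall>j. W j \<omega> \<in> B j}" for B :: "'n \<Rightarrow> real set"
  define boxes where "boxes = {box B |B. \<forall>j. B j \<in> sets borel}"
  have box_meas: "box B \<in> sets M" if "\<And>j. B j \<in> sets borel" for B
    unfolding box_def using that by measurable
  have box_ind: "(\<Prod>j\<in>UNIV. indicator (B j) (W j \<omega>)) = (indicator (box B) \<omega> :: complex)"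
    if "\<omega> \<in> space M" for B \<omega>
    using that by (auto simp: box_def indicator_def prod_zero_iff)
  have iexp_int: "integrable M (\<lambda>\<omega>. iexp (V \<omega>))" if [measurable]: "V \<in> borel_measurable M" for V
    by (rule integrable_const_bound[of _ 1]) auto
  have prod_eq: "prob ((R -` C \<inter> space M) \<inter> box B) = prob (R -` C \<inter> space M) * prob (box B)"
    if B: "\<And>j. B j \<in> sets borel" and C[measurable]: "C \<in> sets borel" for B C
  proof -
    have [measurable]: "box B \<in> sets M" using box_meas B by auto
    \<comment> \<open>First pass: with the centered exponential of \<open>R\<close> as weight,
      \<open>factor\<close> says precisely that all its integrals against exponentials of
      \<open>W\<close> vanish.\<close>
    have 1: "(CLINT \<omega>|M. (iexp (s * R \<omega>) - (CLINT \<omega>|M. iexp (s * R \<omega>))) * indicator (box B) \<omega>) = 0" for s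
    proof -
      let ?h = "\<lambda>\<omega>. iexp (s * R \<omega>) - (CLINT \<omega>|M. iexp (s * R \<omega>))"
      have "(CLINT \<omega>|M. ?h \<omega> * (\<Prod>j\<in>UNIV. indicator (B j) (W j \<omega>))) = 0"
      proof (rule integral_prod_indicator_eq_0)
        show "integrable M ?h" by (intro Bochner_Integration.integrable_diff iexp_int) auto
        fix t
        have "(CLINT \<omega>|M. ?h \<omega> * iexp (\<Sum>j\<in>UNIV. t j * W j \<omega>)) =
           (CLINT \<omega>|M. iexp (s * R \<omega> + (\<Sum>j\<in>UNIV. t j * W j \<omega>)) -
              (CLINT \<omega>|M. iexp (s * R \<omega>)) * iexp (\<Sum>j\<in>UNIV. t j * W j \<omega>))"
          by (simp add: distrib_left exp_add left_diff_distrib)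
        also have "\<dots> = 0"
          by (subst Bochner_Integration.integral_diff)
             (use factor[of s t] in \<open>auto simp del: of_real_add of_real_sum of_real_mult intro!: iexp_int integrable_mult_right\<close>)
        finally show "(CLINT \<omega>|M. ?h \<omega> * iexp (\<Sum>j\<in>UNIV. t j * W j \<omega>)) = 0" .
      qed (use B in auto)
      then show ?thesis
        by (subst (asm) Bochner_Integration.integral_cong[OF refl, where g = "\<lambda>\<omega>. ?h \<omega> * indicator (box B) \<omega>"])
           (auto simp: box_ind)
    qed
    \<comment> \<open>Second pass with the roles exchanged: the weight is the centered indicator of
      the box, the variable is \<open>R\<close>, and the first pass supplies the hypothesis.\<close>
    let ?g = "\<lambda>\<omega>. complex_of_real (indicator (box B) \<omega> - prob (box B))"
    have int_g: "integrable M ?g"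
      by (intro integrable_of_real Bochner_Integration.integrable_diff) (auto simp: less_top[symmetric])
    have "(CLINT \<omega>|M. ?g \<omega> * indicator C (R \<omega>)) = 0"
    proof (rule integral_indicator_eq_0[OF int_g])
      fix s
      have [simp]: "integrable M (\<lambda>\<omega>. iexp (s * R \<omega>) * indicator (box B) \<omega>)"
        by (rule integrable_const_bound[of _ 1]) (auto simp: norm_mult indicator_def)
      have int_box: "integrable M (\<lambda>\<omega>. indicator (box B) \<omega> :: real)"
        by (simp add: less_top[symmetric])
      then have integral_box: "(CLINT \<omega>|M. indicator (box B) \<omega>) = complex_of_real (prob (box B))"
        using integral_complex_of_real[of M "indicator (box B)"] by (simp add: of_real_indicator)
      have [simp]: "integrable M (\<lambda>\<omega>. indicator (box B) \<omega> :: complex)"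
        using integrable_of_real[OF int_box, where 'a = complex] by (simp add: of_real_indicator)
      have "(CLINT \<omega>|M. iexp (s * R \<omega>) * indicator (box B) \<omega>) = (CLINT \<omega>|M. iexp (s * R \<omega>)) * prob (box B)"
        using 1[of s] integrable_of_real[OF int_box, where 'a = complex]
        by (simp add: left_diff_distrib Bochner_Integration.integral_diff integral_box del: of_real_mult)
      moreover have "(CLINT \<omega>|M. ?g \<omega> * iexp (s * R \<omega>)) =
          (CLINT \<omega>|M. iexp (s * R \<omega>) * indicator (box B) \<omega> - prob (box B) * iexp (s * R \<omega>))"
        by (simp add: of_real_indicator algebra_simps)
      ultimately show "(CLINT \<omega>|M. ?g \<omega> * iexp (s * R \<omega>)) = 0"
        using iexp_int[of "\<lambda>\<omega>. s * R \<omega>"] by (simp del: of_real_mult)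
    qed auto
    then have "complex_of_real (\<integral>\<omega>. (indicator (box B) \<omega> - prob (box B)) * indicator C (R \<omega>) \<partial>M) = 0"
      by (simp add: of_real_indicator flip: integral_complex_of_real)
    then have "(\<integral>\<omega>. indicator ((R -` C \<inter> space M) \<inter> box B) \<omega> - prob (box B) * indicator (R -` C \<inter> space M) \<omega> \<partial>M) = 0"
      by (subst Bochner_Integration.integral_cong[OF refl,
            where g = "\<lambda>\<omega>. (indicator (box B) \<omega> - prob (box B)) * indicator C (R \<omega>)"])
         (auto simp: indicator_def)
    then show ?thesis
      by (subst (asm) Bochner_Integration.integral_diff) (auto simp: less_top[symmetric])
  qed
  have "indep_set {R -` B \<inter> space M |B. B \<in> sets borel} boxes"
    unfolding indep_sets2_eq boxes_def using box_meas prod_eq by (auto intro: measurable_sets)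
  then have indep: "indep_set (sigma_sets (space M) {R -` B \<inter> space M |B. B \<in> sets borel}) (sigma_sets (space M) boxes)"
  proof (rule indep_set_sigma_sets)
    show "Int_stable {R -` B \<inter> space M |B. B \<in> sets borel}"
      unfolding Int_stable_def
    proof safe
      fix B C :: "real set" assume "B \<in> sets borel" "C \<in> sets borel"
      then show "\<exists>B'. (R -` B \<inter> space M) \<inter> (R -` C \<inter> space M) = R -` B' \<inter> space M \<and> B' \<in> sets borel"
        by (intro exI[of _ "B \<inter> C"]) auto
    qed
    show "Int_stable boxes"
      unfolding Int_stable_def boxes_def
    proof safe
      fix B C :: "'n \<Rightarrow> real set" assume "\<forall>j. B j \<in> sets borel" "\<forall>j. C j \<in> sets borel"
      then show "\<exists>B'. box B \<inter> box C = box B' \<and> (\<forall>j. B' j \<in> sets borel)"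
        by (intro exI[of _ "\<lambda>j. B j \<inter> C j"]) (auto simp: box_def)
    qed
  qed
  \<comment> \<open>Cylinders over one coordinate generate the product sigma-algebra, and each pulls
    back to a box whose other sides are \<open>UNIV\<close>.\<close>
  have path_eq: "path UNIV W -` {f \<in> UNIV. f i \<in> A} \<inter> space M = box (\<lambda>j. if j = i then A else UNIV)" for i A
    by (auto simp: path_def box_def split: if_splits)
  have "sets (generated_sigma M UNIV W) =
      sigma_sets (space M) {path UNIV W -` A \<inter> space M |A. A \<in> {{f \<in> UNIV. f i \<in> A} |i A. A \<in> sets borel}}"
    unfolding generated_sigma_def sets_PiM_single
    by (subst sets_vimage_algebra2) (auto simp: sigma_sets_vimage_commute sets_PiM_single space_PiM path_def)
  also have "\<dots> \<subseteq> sigma_sets (space M) boxes"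
  proof (rule sigma_sets_mono', safe)
    fix i and A :: "real set" assume "A \<in> sets borel"
    then show "path UNIV W -` {f \<in> UNIV. f i \<in> A} \<inter> space M \<in> boxes"
      unfolding path_eq boxes_def by auto
  qed
  finally have "sets (generated_sigma M UNIV W) \<subseteq> sigma_sets (space M) boxes" .
  with indep show ?thesis
    unfolding indep_sets2_eq sets_vimage_algebra by blast
qed

text \<open>The sigma-algebras generated by \<open>U\<close> and \<open>V\<close> lie inside
  \<open>F\<close> and \<open>G\<close>, and independence passes to smaller sigma-algebras.\<close>

lemma indep_var_subalgebra:
  assumes indep: "indep_set (sets F) (sets G)" and F: "subalgebra M F" and G: "subalgebra M G"
    and U: "U \<in> borel_measurable F" and V: "V \<in> borel_measurable G"
  shows "indep_var borel U borel V"
  unfolding indep_var_eq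
proof (intro conjI)
  show "U \<in> borel_measurable M" "V \<in> borel_measurable M"
    using measurable_from_subalg[OF F U] measurable_from_subalg[OF G V] .
  have "sigma_sets (space M) {W -` A \<inter> space M |A. A \<in> sets borel} \<subseteq> sets H"
    if H: "subalgebra M H" "W \<in> borel_measurable H" for W H
  proof -
    have "{W -` A \<inter> space M |A. A \<in> sets borel} \<subseteq> sets H"
      using H by (auto simp: subalgebra_def dest: measurable_sets)
    then show ?thesis
      using H sets.sigma_sets_subset[of _ H] by (auto simp: subalgebra_def)
  qed
  from this[OF F U] this[OF G V] indep
  show "indep_set (sigma_sets (space M) {U -` A \<inter> space M |A. A \<in> sets borel})
      (sigma_sets (space M) {V -` A \<inter> space M |A. A \<in> sets borel})"
    unfolding indep_sets2_eq by blast
qed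

text \<open>This is the test against events of \<open>F\<close> by which conditional expectations
  are identified below: independence makes \<open>g (R \<omega>)\<close> behave there like its
  mean.\<close>

lemma integral_indicator_indep:
  fixes R :: "'a \<Rightarrow> real" and g :: "real \<Rightarrow> real"
  assumes indep: "indep_set (sets (vimage_algebra (space M) R borel)) (sets F)"
    and [measurable]: "R \<in> borel_measurable M" "g \<in> borel_measurable borel"
    and F: "subalgebra M F" and A: "A \<in> sets F" and int: "integrable M (\<lambda>\<omega>. g (R \<omega>))"
  shows "(\<integral>\<omega>. indicator A \<omega> * g (R \<omega>) \<partial>M) = prob A * (\<integral>\<omega>. g (R \<omega>) \<partial>M)"
proof -
  have [measurable]: "A \<in> sets M" using F A by (auto simp: subalgebra_def)
  have "indep_var borel R borel (indicator A :: 'a \<Rightarrow> real)"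
  proof (rule indep_var_subalgebra[OF indep _ F])
    show "subalgebra M (vimage_algebra (space M) R borel)"
      by (auto simp: subalgebra_def sets_vimage_algebra2)
    show "R \<in> borel_measurable (vimage_algebra (space M) R borel)"
      by (rule measurable_vimage_algebra1) simp
  qed (use A in simp)
  then have "indep_var borel (g \<circ> R) borel (id \<circ> (indicator A :: 'a \<Rightarrow> real))"
    by (rule indep_var_compose) auto
  then have "(\<integral>\<omega>. (g \<circ> R) \<omega> * (id \<circ> indicator A) \<omega> \<partial>M) = (\<integral>\<omega>. (g \<circ> R) \<omega> \<partial>M) * (\<integral>\<omega>. (id \<circ> indicator A) \<omega> \<partial>M)"
    by (rule indep_var_lebesgue_integral) (use int in \<open>auto simp: comp_def less_top[symmetric]\<close>)
  then show ?thesis by (simp add: mult.commute)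
qed

end

section \<open>Gaussian families and conditional covariance\<close>

text \<open>The linear span of the family. A Gaussian process is one whose span consists of Gaussian
  variables, so closure of the span under linear operations replaces all bookkeeping of index sets
  and coefficients.\<close>

definition lin_combs :: "'i set \<Rightarrow> ('i \<Rightarrow> 'w \<Rightarrow> real) \<Rightarrow> ('w \<Rightarrow> real) set" where
  "lin_combs I Z = {U. \<exists>S a. finite S \<and> S \<subseteq> I \<and> U = (\<lambda>\<omega>. \<Sum>i\<in>S. a i * Z i \<omega>)}"

lemma lin_combs_base: "i \<in> I \<Longrightarrow> Z i \<in> lin_combs I Z"
  unfolding lin_combs_def by (auto intro!: exI[of _ "{i}"] exI[of _ "\<lambda>_. 1"])

lemma lin_combs_0: "(\<lambda>\<omega>. 0) \<in> lin_combs I Z"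
  unfolding lin_combs_def by (auto intro!: exI[of _ "{}"])

lemma lin_combs_cmult: 
  assumes "U \<in> lin_combs I Z"
  shows "(\<lambda>\<omega>. c * U \<omega>) \<in> lin_combs I Z"
proof -
  obtain S a where "finite S" "S \<subseteq> I" "U = (\<lambda>\<omega>. \<Sum>i\<in>S. a i * Z i \<omega>)"
    using assms by (auto simp: lin_combs_def)
  then show ?thesis
    unfolding lin_combs_def
    by (auto simp: sum_distrib_left mult.assoc intro!: exI[of _ S] exI[of _ "\<lambda>i. c * a i"])
qed

lemma lin_combs_add: 
  assumes "U \<in> lin_combs I Z" "V \<in> lin_combs I Z"
  shows "(\<lambda>\<omega>. U \<omega> + V \<omega>) \<in> lin_combs I Z"
proof -
  obtain S a T b where S: "finite S" "S \<subseteq> I" "U = (\<lambda>\<omega>. \<Sum>i\<in>S. a i * Z i \<omega>)"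
      and T: "finite T" "T \<subseteq> I" "V = (\<lambda>\<omega>. \<Sum>i\<in>T. b i * Z i \<omega>)"
    using assms by (auto simp: lin_combs_def)
  \<comment> \<open>The two combinations may use different indices; extending the coefficients by
    zero puts both on \<open>S \<union> T\<close>.\<close>
  have "U \<omega> = (\<Sum>i\<in>S \<union> T. (if i \<in> S then a i else 0) * Z i \<omega>)" for \<omega>
    unfolding S(3) using S T by (intro sum.mono_neutral_cong_left) auto
  moreover have "V \<omega> = (\<Sum>i\<in>S \<union> T. (if i \<in> T then b i else 0) * Z i \<omega>)" for \<omega>
    unfolding T(3) using S T by (intro sum.mono_neutral_cong_left) auto
  ultimately have "(\<lambda>\<omega>. U \<omega> + V \<omega>) = (\<lambda>\<omega>. \<Sum>i\<in>S \<union> T. ((if i \<in> S then a i else 0) + (if i \<in> T then b i else 0)) * Z i \<omega>)"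
    by (simp only: sum.distrib distrib_right)
  then show ?thesis
    unfolding lin_combs_def using S T
    by (intro CollectI exI[of _ "S \<union> T"] exI[of _ "\<lambda>i. (if i \<in> S then a i else 0) + (if i \<in> T then b i else 0)"]) simp
qed

lemma lin_combs_diff:
  "U \<in> lin_combs I Z \<Longrightarrow> V \<in> lin_combs I Z \<Longrightarrow> (\<lambda>\<omega>. U \<omega> - V \<omega>) \<in> lin_combs I Z"
  using lin_combs_add[OF _ lin_combs_cmult[of V _ _ "-1"]] by simp

lemma lin_combs_sum:
  "(\<And>j. j \<in> J \<Longrightarrow> U j \<in> lin_combs I Z) \<Longrightarrow> (\<lambda>\<omega>. \<Sum>j\<in>J. a j * U j \<omega>) \<in> lin_combs I Z"
proof (induction J rule: infinite_finite_induct)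
  case (insert j J)
  then have "(\<lambda>\<omega>. a j * U j \<omega> + (\<Sum>j\<in>J. a j * U j \<omega>)) \<in> lin_combs I Z"
    by (intro lin_combs_add lin_combs_cmult) auto
  with insert.hyps show ?case by simp
qed (auto intro: lin_combs_0)

lemmas lin_combs_intros = lin_combs_base lin_combs_cmult lin_combs_add lin_combs_diff lin_combs_sum

lemma gaussian_rv_lin_comb:
  "gaussian_process M I Z \<Longrightarrow> U \<in> lin_combs I Z \<Longrightarrow> gaussian_rv M U"
  by (auto simp: lin_combs_def gaussian_process_def)

section \<open>Centered square-integrable variables and their covariances\<close>

definition centered_L2 :: "'w measure \<Rightarrow> ('w \<Rightarrow> real) set" where
  "centered_L2 M = {U. U \<in> borel_measurable M \<and> integrable M (\<lambda>\<omega>. (U \<omega>)\<^sup>2) \<and> integral\<^sup>L M U = 0}"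

lemma centered_L2_iff: "centered_square_integrable M I Z \<longleftrightarrow> (\<forall>i\<in>I. Z i \<in> centered_L2 M)"
  by (auto simp: centered_square_integrable_def centered_L2_def)

lemma centered_L2_measurable: "U \<in> centered_L2 M \<Longrightarrow> U \<in> borel_measurable M"
  by (simp add: centered_L2_def)

lemma integrable_mult_L2:
  assumes "U \<in> centered_L2 M" "V \<in> centered_L2 M"
  shows "integrable M (\<lambda>\<omega>. U \<omega> * V \<omega>)"
proof (rule Bochner_Integration.integrable_bound)
  show "integrable M (\<lambda>\<omega>. (U \<omega>)\<^sup>2 + (V \<omega>)\<^sup>2)"
    using assms by (simp add: centered_L2_def)
  show "AE \<omega> in M. norm (U \<omega> * V \<omega>) \<le> norm ((U \<omega>)\<^sup>2 + (V \<omega>)\<^sup>2)"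
  proof (rule AE_I2)
    fix \<omega>
    have "2 * \<bar>U \<omega>\<bar> * \<bar>V \<omega>\<bar> \<le> (U \<omega>)\<^sup>2 + (V \<omega>)\<^sup>2"
      using sum_squares_bound[of "\<bar>U \<omega>\<bar>" "\<bar>V \<omega>\<bar>"] by simp
    moreover have "0 \<le> \<bar>U \<omega>\<bar> * \<bar>V \<omega>\<bar>" by simp
    ultimately have "\<bar>U \<omega>\<bar> * \<bar>V \<omega>\<bar> \<le> (U \<omega>)\<^sup>2 + (V \<omega>)\<^sup>2"
      by linarith
    then show "norm (U \<omega> * V \<omega>) \<le> norm ((U \<omega>)\<^sup>2 + (V \<omega>)\<^sup>2)"
      by (simp add: abs_mult)
  qed
qed (use assms in \<open>auto simp: centered_L2_def\<close>)

context prob_space begin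

lemma centered_L2_integrable: "U \<in> centered_L2 M \<Longrightarrow> integrable M U"
  unfolding centered_L2_def by (auto intro: square_integrable_imp_integrable)

lemma centered_L2_0: "(\<lambda>\<omega>. 0) \<in> centered_L2 M"
  by (simp add: centered_L2_def)

lemma centered_L2_cmult: "U \<in> centered_L2 M \<Longrightarrow> (\<lambda>\<omega>. c * U \<omega>) \<in> centered_L2 M"
  by (auto simp: centered_L2_def power_mult_distrib)

lemma centered_L2_add:
  assumes "U \<in> centered_L2 M" "V \<in> centered_L2 M"
  shows "(\<lambda>\<omega>. U \<omega> + V \<omega>) \<in> centered_L2 M"
  using assms integrable_mult_L2[OF assms] centered_L2_integrable[OF assms(1)] centered_L2_integrable[OF assms(2)]
  by (simp add: centered_L2_def power2_sum mult.assoc)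

lemma centered_L2_sum:
  "(\<And>j. j \<in> J \<Longrightarrow> U j \<in> centered_L2 M) \<Longrightarrow> (\<lambda>\<omega>. \<Sum>j\<in>J. a j * U j \<omega>) \<in> centered_L2 M"
proof (induction J rule: infinite_finite_induct)
  case (insert j J)
  then have "(\<lambda>\<omega>. a j * U j \<omega> + (\<Sum>j\<in>J. a j * U j \<omega>)) \<in> centered_L2 M"
    by (intro centered_L2_add centered_L2_cmult) auto
  with insert.hyps show ?case by simp
qed (auto intro: centered_L2_0)

lemma lin_combs_centered_L2:
  "centered_square_integrable M I Z \<Longrightarrow> U \<in> lin_combs I Z \<Longrightarrow> U \<in> centered_L2 M"
  by (auto simp: lin_combs_def centered_L2_iff intro!: centered_L2_sum)

lemma covariance_centered:
  "U \<in> centered_L2 M \<Longrightarrow> V \<in> centered_L2 M \<Longrightarrow> covariance M U V = (\<integral>\<omega>. U \<omega> * V \<omega> \<partial>M)"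
  by (simp add: covariance_def centered_L2_def)

lemma integral_mult_sum_L2:
  assumes "U \<in> centered_L2 M" "\<And>j. j \<in> J \<Longrightarrow> V j \<in> centered_L2 M"
  shows "(\<integral>\<omega>. U \<omega> * (\<Sum>j\<in>J. a j * V j \<omega>) \<partial>M) = (\<Sum>j\<in>J. a j * (\<integral>\<omega>. U \<omega> * V j \<omega> \<partial>M))"
proof -
  have "(\<integral>\<omega>. U \<omega> * (\<Sum>j\<in>J. a j * V j \<omega>) \<partial>M) = (\<integral>\<omega>. (\<Sum>j\<in>J. a j * (U \<omega> * V j \<omega>)) \<partial>M)"
    by (simp add: sum_distrib_left mult.left_commute)
  also have "\<dots> = (\<Sum>j\<in>J. \<integral>\<omega>. a j * (U \<omega> * V j \<omega>) \<partial>M)"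
    by (rule Bochner_Integration.integral_sum) (use assms in \<open>auto intro: integrable_mult_L2\<close>)
  finally show ?thesis by simp
qed

text \<open>A centered Gaussian variable enters its characteristic function only through its
  variance. Applied to linear combinations, the value at frequency 1 covers all frequencies.\<close>

lemma iexp_centered_gaussian:
  assumes "gaussian_rv M U" "U \<in> centered_L2 M"
  shows "(CLINT \<omega>|M. iexp (U \<omega>)) = exp (- (\<integral>\<omega>. (U \<omega>)\<^sup>2 \<partial>M) / 2)"
proof -
  have U[measurable]: "U \<in> borel_measurable M" and U0: "(\<integral>\<omega>. U \<omega> \<partial>M) = 0"
    using assms(2) by (auto simp: centered_L2_def)
  consider \<mu> where "AE \<omega> in M. U \<omega> = \<mu>" | \<mu> \<sigma> where "\<sigma> > 0" "distributed M lborel U (normal_density \<mu> \<sigma>)"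
    using assms(1) unfolding gaussian_rv_def by auto
  then show ?thesis
  proof cases
    \<comment> \<open>A centered variable that is almost surely constant is zero, and both sides
      equal 1.\<close>
    case 1
    then have "(\<integral>\<omega>. U \<omega> \<partial>M) = (\<integral>\<omega>. \<mu> \<partial>M)"
      by (intro integral_cong_AE) auto
    with U0 have "\<mu> = 0" by (simp add: prob_space)
    with 1 have U_0: "AE \<omega> in M. U \<omega> = 0" by simp
    have "(CLINT \<omega>|M. iexp (U \<omega>)) = (CLINT \<omega>|M. 1)"
      by (rule integral_cong_AE) (use U_0 in auto)
    moreover have "(\<integral>\<omega>. (U \<omega>)\<^sup>2 \<partial>M) = (\<integral>\<omega>. 0 \<partial>M)"
      by (rule integral_cong_AE) (use U_0 in auto)
    ultimately show ?thesis by (simp add: prob_space)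
  next
    case 2
    have "\<mu> = 0"
      using normal_distributed_expectation[OF 2] U0 by simp
    have "(\<integral>\<omega>. (U \<omega>)\<^sup>2 \<partial>M) = \<sigma>\<^sup>2"
      using normal_distributed_variance[OF 2] U0 by simp
    \<comment> \<open>The formula is known for the standard normal law; evaluating the
      characteristic function of \<open>U / \<sigma>\<close> at \<open>\<sigma>\<close> undoes the
      scaling.\<close>
    moreover have "distributed M lborel (\<lambda>\<omega>. U \<omega> / \<sigma>) std_normal_density"
      using 2 normal_standard_normal_convert[of \<sigma> U \<mu>] \<open>\<mu> = 0\<close> by simp
    then have "distr M lborel (\<lambda>\<omega>. U \<omega> / \<sigma>) = std_normal_distribution"
      by (simp add: distributed_def)
    moreover have "char (distr M lborel (\<lambda>\<omega>. U \<omega> / \<sigma>)) \<sigma> = (CLINT \<omega>|M. iexp (U \<omega>))"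
      unfolding char_def using \<open>\<sigma> > 0\<close> by (subst integral_distr) auto
    ultimately show ?thesis
      by (simp add: char_std_normal_distribution)
  qed
qed

text \<open>Without correlation the cross term in the variance of
  \<open>s * R + t \<bullet> W\<close> vanishes. The variance is then additive, its exponential
  multiplicative, and the joint characteristic function factorises.\<close>

lemma gaussian_uncorrelated_indep:
  fixes W :: "'n::finite \<Rightarrow> 'a \<Rightarrow> real"
  assumes gauss: "gaussian_process M I Z" and L2: "centered_square_integrable M I Z"
    and R: "R \<in> lin_combs I Z" and W: "\<And>j. W j \<in> lin_combs I Z"
    and uncorr: "\<And>j. (\<integral>\<omega>. R \<omega> * W j \<omega> \<partial>M) = 0"
  shows "indep_set (sets (vimage_algebra (space M) R borel))
    (sets (generated_sigma M UNIV W))"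
proof (rule indep_set_char_factor)
  note L2' = lin_combs_centered_L2[OF L2]
  fix s t
  let ?V = "\<lambda>\<omega>. \<Sum>j\<in>UNIV. t j * W j \<omega>"
  have V: "?V \<in> lin_combs I Z" and sR: "(\<lambda>\<omega>. s * R \<omega>) \<in> lin_combs I Z"
    using R W by (auto intro!: lin_combs_intros)
  note UV = lin_combs_add[OF sR V]
  have "(\<integral>\<omega>. R \<omega> * ?V \<omega> \<partial>M) = 0"
    using R W uncorr by (simp add: integral_mult_sum_L2 L2')
  moreover have "(\<integral>\<omega>. (s * R \<omega> + ?V \<omega>)\<^sup>2 \<partial>M) =
      (\<integral>\<omega>. (s * R \<omega>)\<^sup>2 + 2 * s * (R \<omega> * ?V \<omega>) + (?V \<omega>)\<^sup>2 \<partial>M)"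
    by (simp add: power2_sum algebra_simps)
  moreover have "integrable M (\<lambda>\<omega>. (s * R \<omega>)\<^sup>2)" "integrable M (\<lambda>\<omega>. (?V \<omega>)\<^sup>2)" "integrable M (\<lambda>\<omega>. R \<omega> * ?V \<omega>)"
    using L2'[OF sR] L2'[OF V] integrable_mult_L2[OF L2'[OF R] L2'[OF V]] by (auto simp: centered_L2_def)
  ultimately have "(\<integral>\<omega>. (s * R \<omega> + ?V \<omega>)\<^sup>2 \<partial>M) = (\<integral>\<omega>. (s * R \<omega>)\<^sup>2 \<partial>M) + (\<integral>\<omega>. (?V \<omega>)\<^sup>2 \<partial>M)"
    by simp
  then show "(CLINT \<omega>|M. iexp (s * R \<omega> + ?V \<omega>)) = (CLINT \<omega>|M. iexp (s * R \<omega>)) * (CLINT \<omega>|M. iexp (?V \<omega>))"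
    using iexp_centered_gaussian[OF gaussian_rv_lin_comb[OF gauss UV] L2'[OF UV]]
      iexp_centered_gaussian[OF gaussian_rv_lin_comb[OF gauss sR] L2'[OF sR]]
      iexp_centered_gaussian[OF gaussian_rv_lin_comb[OF gauss V] L2'[OF V]]
    by (simp add: exp_add[symmetric] add_divide_distrib del: of_real_add of_real_mult of_real_sum flip: of_real_mult)
qed (use R W lin_combs_centered_L2[OF L2] in \<open>auto simp: centered_L2_measurable\<close>)


section \<open>Generated sigma-algebras and Gaussian conditioning\<close>

lemma subalgebra_generated_sigma:
  assumes "\<And>i. i \<in> I \<Longrightarrow> Z i \<in> borel_measurable M"
  shows "subalgebra M (generated_sigma M I Z)"
proof -
  have "path I Z \<in> measurable M (PiM I (\<lambda>_. borel))"
    unfolding path_def[abs_def] using assms by measurable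
  then show ?thesis
    unfolding subalgebra_def generated_sigma_def
    by (auto simp: sets_vimage_algebra2 measurable_space intro: measurable_sets)
qed

lemma path_measurable_generated_sigma:
  "path I Z \<in> measurable (generated_sigma M I Z) (PiM I (\<lambda>_. borel))"
  unfolding generated_sigma_def
  by (rule measurable_vimage_algebra1) (auto simp: path_def space_PiM)

lemma measurable_generated_sigma:
  assumes "i \<in> I"
  shows "Z i \<in> borel_measurable (generated_sigma M I Z)"
proof -
  have "(\<lambda>\<omega>. path I Z \<omega> i) \<in> borel_measurable (generated_sigma M I Z)"
    using assms
    by (intro measurable_compose[OF path_measurable_generated_sigma measurable_component_singleton])
  then show ?thesis using assms by (simp add: path_def)
qed

text \<open>The coefficients \<open>a\<close> and \<open>b\<close> solve the normal equations of the
  regression on \<open>W\<close>, so the residuals of \<open>U\<close> and \<open>V\<close> are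
  uncorrelated with \<open>W\<close> and hence independent of its sigma-algebra. The regressions are
  therefore the conditional expectations, and the product of the residuals has a constant
  conditional mean.\<close>

lemma gaussian_cond_covariance:
  fixes W :: "'n::finite \<Rightarrow> 'a \<Rightarrow> real"
  assumes gauss: "gaussian_process M I Z" and L2: "centered_square_integrable M I Z"
    and U: "U \<in> lin_combs I Z" and V: "V \<in> lin_combs I Z" and W: "\<And>j. W j \<in> lin_combs I Z"
    and normal_U: "\<And>i. (\<integral>\<omega>. U \<omega> * W i \<omega> \<partial>M) = (\<Sum>j\<in>UNIV. a j * (\<integral>\<omega>. W i \<omega> * W j \<omega> \<partial>M))"
    and normal_V: "\<And>i. (\<integral>\<omega>. V \<omega> * W i \<omega> \<partial>M) = (\<Sum>j\<in>UNIV. b j * (\<integral>\<omega>. W i \<omega> * W j \<omega> \<partial>M))"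
  shows "AE \<omega> in M. cond_covariance M (generated_sigma M UNIV W) U V \<omega> =
    (\<integral>\<omega>. U \<omega> * V \<omega> \<partial>M) - (\<Sum>j\<in>UNIV. a j * (\<integral>\<omega>. V \<omega> * W j \<omega> \<partial>M))"
proof -
  note L2' = lin_combs_centered_L2[OF L2]
  define F where "F = generated_sigma M UNIV W"
  have F: "subalgebra M F"
    unfolding F_def by (rule subalgebra_generated_sigma) (rule centered_L2_measurable[OF L2'[OF W]])
  interpret F: finite_measure_subalgebra M F by unfold_locales (rule F)
  have W_F[measurable]: "W j \<in> borel_measurable F" for j
    unfolding F_def by (rule measurable_generated_sigma) simp
  have W_M[measurable]: "W j \<in> borel_measurable M" for j
    by (rule centered_L2_measurable[OF L2'[OF W]])
  have lin_W: "(\<lambda>\<omega>. \<Sum>j\<in>UNIV. c j * W j \<omega>) \<in> lin_combs I Z" for c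
    using W by (auto intro!: lin_combs_sum)
  have resid_uncorr: "(\<integral>\<omega>. (S \<omega> - (\<Sum>j\<in>UNIV. c j * W j \<omega>)) * W i \<omega> \<partial>M) = 0"
    if S: "S \<in> lin_combs I Z" and
      "(\<integral>\<omega>. S \<omega> * W i \<omega> \<partial>M) = (\<Sum>j\<in>UNIV. c j * (\<integral>\<omega>. W i \<omega> * W j \<omega> \<partial>M))" for S c i
  proof -
    have "(\<integral>\<omega>. (S \<omega> - (\<Sum>j\<in>UNIV. c j * W j \<omega>)) * W i \<omega> \<partial>M) =
        (\<integral>\<omega>. S \<omega> * W i \<omega> - W i \<omega> * (\<Sum>j\<in>UNIV. c j * W j \<omega>) \<partial>M)"
      by (simp add: algebra_simps)
    also have "\<dots> = (\<integral>\<omega>. S \<omega> * W i \<omega> \<partial>M) - (\<integral>\<omega>. W i \<omega> * (\<Sum>j\<in>UNIV. c j * W j \<omega>) \<partial>M)"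
      by (intro Bochner_Integration.integral_diff integrable_mult_L2 L2' W S lin_W)
    also have "\<dots> = 0"
      using that by (simp add: integral_mult_sum_L2 L2' W)
    finally show ?thesis .
  qed
  have indep: "indep_set (sets (vimage_algebra (space M) S borel)) (sets F)"
    if "S \<in> lin_combs I Z" "\<And>i. (\<integral>\<omega>. S \<omega> * W i \<omega> \<partial>M) = 0" for S
    unfolding F_def by (rule gaussian_uncorrelated_indep[OF gauss L2 that(1) W that(2)])
  define RU where "RU \<omega> = U \<omega> - (\<Sum>j\<in>UNIV. a j * W j \<omega>)" for \<omega>
  define RV where "RV \<omega> = V \<omega> - (\<Sum>j\<in>UNIV. b j * W j \<omega>)" for \<omega>
  have R: "RU \<in> lin_combs I Z" "RV \<in> lin_combs I Z"
    unfolding RU_def[abs_def] RV_def[abs_def] using U V lin_W by (auto intro!: lin_combs_diff)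
  have R_uncorr: "(\<integral>\<omega>. RU \<omega> * W i \<omega> \<partial>M) = 0" "(\<integral>\<omega>. RV \<omega> * W i \<omega> \<partial>M) = 0" for i
    unfolding RU_def RV_def using resid_uncorr U V normal_U normal_V by auto
  have meas[measurable]: "U \<in> borel_measurable M" "V \<in> borel_measurable M"
      "RU \<in> borel_measurable M" "RV \<in> borel_measurable M"
    using U V R by (auto intro: centered_L2_measurable L2')
  \<comment> \<open>The residual \<open>T\<close> is centered and independent of \<open>F\<close>,
    so it integrates to zero over every event of \<open>F\<close>; this characterises the regression
    as the conditional expectation of \<open>S\<close>.\<close>
  have cond_exp: "AE \<omega> in M. real_cond_exp M F S \<omega> = (\<Sum>j\<in>UNIV. c j * W j \<omega>)"
    if S: "S \<in> lin_combs I Z"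
      and T: "T \<in> lin_combs I Z" "T = (\<lambda>\<omega>. S \<omega> - (\<Sum>j\<in>UNIV. c j * W j \<omega>))"
      and T_uncorr: "\<And>i. (\<integral>\<omega>. T \<omega> * W i \<omega> \<partial>M) = 0" for S T c
  proof (rule F.real_cond_exp_charact)
    show int: "integrable M S" "integrable M (\<lambda>\<omega>. \<Sum>j\<in>UNIV. c j * W j \<omega>)"
      using S lin_W by (auto intro: centered_L2_integrable L2')
    fix A assume A: "A \<in> sets F"
    then have A_M: "A \<in> sets M" using F by (auto simp: subalgebra_def)
    have T_L2: "T \<in> centered_L2 M" using T(1) by (rule L2')
    have "(\<integral>\<omega>. indicator A \<omega> * T \<omega> \<partial>M) = prob A * (\<integral>\<omega>. T \<omega> \<partial>M)"
      using integral_indicator_indep[OF indep[OF T(1) T_uncorr] _ _ F A, of "\<lambda>x. x"] T_L2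
      by (auto simp: centered_L2_measurable centered_L2_integrable)
    also have "\<dots> = 0" using T_L2 by (simp add: centered_L2_def)
    finally have "(\<integral>\<omega>. indicator A \<omega> * S \<omega> - indicator A \<omega> * (\<Sum>j\<in>UNIV. c j * W j \<omega>) \<partial>M) = 0"
      unfolding T(2) by (simp only: right_diff_distrib)
    moreover have "integrable M (\<lambda>\<omega>. indicator A \<omega> * S \<omega>)" "integrable M (\<lambda>\<omega>. indicator A \<omega> * (\<Sum>j\<in>UNIV. c j * W j \<omega>))"
      using integrable_mult_indicator[OF A_M int(1)] integrable_mult_indicator[OF A_M int(2)] by auto
    ultimately show "(\<integral>\<omega>\<in>A. S \<omega> \<partial>M) = (\<integral>\<omega>\<in>A. (\<Sum>j\<in>UNIV. c j * W j \<omega>) \<partial>M)"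
      by (simp add: set_lebesgue_integral_def)
  qed measurable
  have sq: "(\<integral>\<omega>. indicator A \<omega> * (S \<omega>)\<^sup>2 \<partial>M) = prob A * (\<integral>\<omega>. (S \<omega>)\<^sup>2 \<partial>M)"
    if "A \<in> sets F" and S: "S \<in> lin_combs I Z" "\<And>i. (\<integral>\<omega>. S \<omega> * W i \<omega> \<partial>M) = 0" for A S
    using integral_indicator_indep[OF indep[OF S] _ _ F \<open>A \<in> sets F\<close>, of "\<lambda>x. x\<^sup>2"] L2'[OF S(1)]
    by (auto simp: centered_L2_def)
  have "AE \<omega> in M. real_cond_exp M F (\<lambda>\<omega>. RU \<omega> * RV \<omega>) \<omega> = (\<integral>\<omega>. RU \<omega> * RV \<omega> \<partial>M)"
  proof (rule F.real_cond_exp_charact)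
    show int: "integrable M (\<lambda>\<omega>. RU \<omega> * RV \<omega>)"
      using R by (intro integrable_mult_L2 L2')
    fix A assume A: "A \<in> sets F"
    then have A_M[measurable]: "A \<in> sets M" using F by (auto simp: subalgebra_def)
    \<comment> \<open>All combinations \<open>RU + s * RV\<close> are again uncorrelated with
      \<open>W\<close>, so their squares also average over \<open>A\<close> in proportion to
      \<open>prob A\<close>.\<close>
    have "(\<integral>\<omega>. (RU \<omega> + s * RV \<omega>) * W i \<omega> \<partial>M) = 0" for s i
    proof -
      have "(\<integral>\<omega>. (RU \<omega> + s * RV \<omega>) * W i \<omega> \<partial>M) = (\<integral>\<omega>. RU \<omega> * W i \<omega> + s * (RV \<omega> * W i \<omega>) \<partial>M)"
        by (simp add: algebra_simps)
      also have "\<dots> = 0"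
        using R_uncorr[of i] R W by (simp add: integrable_mult_L2 L2')
      finally show ?thesis .
    qed
    moreover have "(\<lambda>\<omega>. RU \<omega> + s * RV \<omega>) \<in> lin_combs I Z" for s
      using R by (auto intro!: lin_combs_add lin_combs_cmult)
    ultimately have sq': "(\<integral>\<omega>. indicator A \<omega> * (RU \<omega> + s * RV \<omega>)\<^sup>2 \<partial>M) = prob A * (\<integral>\<omega>. (RU \<omega> + s * RV \<omega>)\<^sup>2 \<partial>M)"
        and int': "integrable M (\<lambda>\<omega>. (RU \<omega> + s * RV \<omega>)\<^sup>2)" for s
      using sq[OF A] L2' by (auto simp: centered_L2_def)
    have int'': "integrable M (\<lambda>\<omega>. indicator A \<omega> * (RU \<omega> + s * RV \<omega>)\<^sup>2)" for s
      using integrable_mult_indicator[OF A_M int'[of s]] by simp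
    \<comment> \<open>Independence of \<open>F\<close> is available for one linear combination at a
      time, not for the pair of residuals. Polarisation reduces their product to the squares with
      \<open>s = 1\<close> and \<open>s = -1\<close>.\<close>
    have polar: "RU \<omega> * RV \<omega> = ((RU \<omega> + 1 * RV \<omega>)\<^sup>2 - (RU \<omega> + (-1) * RV \<omega>)\<^sup>2) / 4" for \<omega>
      by (simp add: power2_eq_square field_simps)
    have "(\<integral>\<omega>. indicator A \<omega> * (RU \<omega> * RV \<omega>) \<partial>M) = prob A * (\<integral>\<omega>. RU \<omega> * RV \<omega> \<partial>M)"
      unfolding polar times_divide_eq_right right_diff_distrib
      using int'[of 1] int'[of "-1"] int''[of 1] int''[of "-1"] sq'[of 1] sq'[of "-1"]
      by (simp add: diff_divide_distrib right_diff_distrib)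
    then show "(\<integral>\<omega>\<in>A. RU \<omega> * RV \<omega> \<partial>M) = (\<integral>\<omega>\<in>A. (\<integral>\<omega>. RU \<omega> * RV \<omega> \<partial>M) \<partial>M)"
      using A_M by (simp add: set_lebesgue_integral_def mult.commute)
  qed simp_all
  moreover have "AE \<omega> in M. real_cond_exp M F
      (\<lambda>\<omega>. (U \<omega> - real_cond_exp M F U \<omega>) * (V \<omega> - real_cond_exp M F V \<omega>)) \<omega> =
      real_cond_exp M F (\<lambda>\<omega>. RU \<omega> * RV \<omega>) \<omega>"
  \<comment> \<open>The inner conditional expectations are determined only almost surely; replacing
    them by the regressions leaves the product of the residuals.\<close>
  proof (rule F.real_cond_exp_cong)
    have "AE \<omega> in M. real_cond_exp M F U \<omega> = (\<Sum>j\<in>UNIV. a j * W j \<omega>)"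
      by (rule cond_exp[OF U R(1)]) (use R_uncorr in \<open>auto simp: RU_def\<close>)
    moreover have "AE \<omega> in M. real_cond_exp M F V \<omega> = (\<Sum>j\<in>UNIV. b j * W j \<omega>)"
      by (rule cond_exp[OF V R(2)]) (use R_uncorr in \<open>auto simp: RV_def\<close>)
    ultimately show "AE \<omega> in M. (U \<omega> - real_cond_exp M F U \<omega>) * (V \<omega> - real_cond_exp M F V \<omega>) = RU \<omega> * RV \<omega>"
      by eventually_elim (simp add: RU_def RV_def)
  qed measurable
  \<comment> \<open>\<open>RU\<close> is orthogonal to the span of \<open>W\<close>, so the
    regression part of \<open>RV\<close> drops out and only the coefficients \<open>a\<close> remain
    in the result.\<close>
  moreover have "(\<integral>\<omega>. RU \<omega> * RV \<omega> \<partial>M) = (\<integral>\<omega>. U \<omega> * V \<omega> \<partial>M) - (\<Sum>j\<in>UNIV. a j * (\<integral>\<omega>. V \<omega> * W j \<omega> \<partial>M))"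
  proof -
    have "(\<integral>\<omega>. RU \<omega> * (\<Sum>j\<in>UNIV. b j * W j \<omega>) \<partial>M) = 0"
      using R W R_uncorr by (simp add: integral_mult_sum_L2 L2')
    moreover have "(\<integral>\<omega>. RU \<omega> * RV \<omega> \<partial>M) = (\<integral>\<omega>. U \<omega> * V \<omega> - V \<omega> * (\<Sum>j\<in>UNIV. a j * W j \<omega>) - RU \<omega> * (\<Sum>j\<in>UNIV. b j * W j \<omega>) \<partial>M)"
      by (simp add: RU_def RV_def algebra_simps)
    moreover have "\<dots> = (\<integral>\<omega>. U \<omega> * V \<omega> \<partial>M) - (\<integral>\<omega>. V \<omega> * (\<Sum>j\<in>UNIV. a j * W j \<omega>) \<partial>M) - (\<integral>\<omega>. RU \<omega> * (\<Sum>j\<in>UNIV. b j * W j \<omega>) \<partial>M)"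
      using integrable_mult_L2[OF L2'[OF U] L2'[OF V]] integrable_mult_L2[OF L2'[OF V] L2'[OF lin_W]]
        integrable_mult_L2[OF L2'[OF R(1)] L2'[OF lin_W]] by simp
    moreover have "(\<integral>\<omega>. V \<omega> * (\<Sum>j\<in>UNIV. a j * W j \<omega>) \<partial>M) = (\<Sum>j\<in>UNIV. a j * (\<integral>\<omega>. V \<omega> * W j \<omega> \<partial>M))"
      using V W by (simp add: integral_mult_sum_L2 L2')
    ultimately show ?thesis by simp
  qed
  ultimately show ?thesis
    unfolding cond_covariance_def F_def by auto
qed

end

section \<open>Sums with an independent replicate\<close>

text \<open>Being Gaussian is a property of the law, in the degenerate case as well as in the case
  with a density.\<close>

lemma gaussian_rv_distr_eq:
  assumes "gaussian_rv P V" "U \<in> borel_measurable P" "distr P borel U = distr P borel V"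
  shows "gaussian_rv P U"
proof -
  have V: "V \<in> borel_measurable P" using assms(1) by (simp add: gaussian_rv_def)
  have "(AE \<omega> in P. U \<omega> = \<mu>) \<longleftrightarrow> (AE \<omega> in P. V \<omega> = \<mu>)" for \<mu>
  proof -
    have "(AE \<omega> in P. T \<omega> = \<mu>) \<longleftrightarrow> (AE x in distr P borel T. x = \<mu>)" if "T \<in> borel_measurable P" for T
      using that by (simp add: AE_distr_iff)
    from this[OF assms(2)] this[OF V] show ?thesis
      unfolding assms(3) by blast
  qed
  \<comment> \<open>\<open>distributed\<close> is stated with target \<open>lborel\<close>; only the
    measurable sets of the target matter for \<open>distr\<close>, and these are the Borel
    sets.\<close>
  moreover have "distr P lborel U = distr P lborel V"
    using assms(3) distr_cong[of P P lborel borel U U] distr_cong[of P P lborel borel V V] by simp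
  ultimately show ?thesis
    using assms(1,2) unfolding gaussian_rv_def distributed_def by auto
qed

context prob_space begin

lemma gaussian_rv_add_const:
  assumes "gaussian_rv M U"
  shows "gaussian_rv M (\<lambda>\<omega>. c + U \<omega>)"
proof -
  consider \<mu> where "AE \<omega> in M. U \<omega> = \<mu>" | \<mu> \<sigma> where "\<sigma> > 0" "distributed M lborel U (normal_density \<mu> \<sigma>)"
    using assms unfolding gaussian_rv_def by auto
  then show ?thesis
  proof cases
    case 1
    then have "AE \<omega> in M. c + U \<omega> = c + \<mu>" by simp
    then show ?thesis using assms unfolding gaussian_rv_def by auto
  next
    case 2
    then show ?thesis
      using assms normal_density_affine[OF 2(2,1), of 1 c] unfolding gaussian_rv_def by auto
  qed
qed

lemma gaussian_rv_AE_cong: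
  assumes "gaussian_rv M V" "U \<in> borel_measurable M" "AE \<omega> in M. U \<omega> = V \<omega>"
  shows "gaussian_rv M U"
proof (rule gaussian_rv_distr_eq[OF assms(1,2)])
  show "distr M borel U = distr M borel V"
    by (rule distr_cong_AE) (use assms in \<open>auto simp: gaussian_rv_def\<close>)
qed

text \<open>A degenerate summand merely shifts the other one, up to a null set; the remaining case
  is the sum of two independent variables with normal densities.\<close>

lemma gaussian_rv_add_indep:
  assumes U: "gaussian_rv M U" and V: "gaussian_rv M V" and indep: "indep_var borel U borel V"
  shows "gaussian_rv M (\<lambda>\<omega>. U \<omega> + V \<omega>)"
proof -
  have [measurable]: "U \<in> borel_measurable M" "V \<in> borel_measurable M"
    using U V by (auto simp: gaussian_rv_def)
  consider \<mu> where "AE \<omega> in M. U \<omega> = \<mu>" | \<mu> where "AE \<omega> in M. V \<omega> = \<mu>"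
    | \<mu> \<sigma> \<nu> \<tau> where "\<sigma> > 0" "distributed M lborel U (normal_density \<mu> \<sigma>)"
        "\<tau> > 0" "distributed M lborel V (normal_density \<nu> \<tau>)"
    using U V unfolding gaussian_rv_def by auto
  then show ?thesis
  proof cases
    case 1
    then have "AE \<omega> in M. U \<omega> + V \<omega> = \<mu> + V \<omega>" by simp
    then show ?thesis by (rule gaussian_rv_AE_cong[OF gaussian_rv_add_const[OF V], rotated]) measurable
  next
    case 2
    then have "AE \<omega> in M. U \<omega> + V \<omega> = \<mu> + U \<omega>" by simp
    then show ?thesis by (rule gaussian_rv_AE_cong[OF gaussian_rv_add_const[OF U], rotated]) measurable
  next
    case 3
    have "distributed M lborel (\<lambda>\<omega>. U \<omega> + V \<omega>) (normal_density (\<mu> + \<nu>) (sqrt (\<sigma>\<^sup>2 + \<tau>\<^sup>2)))"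
      using 3 by (intro add_indep_normal indep)
    moreover have "sqrt (\<sigma>\<^sup>2 + \<tau>\<^sup>2) > 0"
      using 3 by (simp add: sum_power2_gt_zero_iff)
    moreover have "(\<lambda>\<omega>. U \<omega> + V \<omega>) \<in> borel_measurable M"
      by measurable
    ultimately show ?thesis unfolding gaussian_rv_def by blast
  qed
qed

section \<open>Independent replicates of a process\<close>

lemma lin_combs_measurable_generated_sigma:
  "U \<in> lin_combs I Z \<Longrightarrow> U \<in> borel_measurable (generated_sigma M I Z)"
  by (auto simp: lin_combs_def intro!: borel_measurable_sum borel_measurable_times measurable_generated_sigma)

lemma replicate_measurable:
  "independent_replicate M D E R I Z \<Longrightarrow> x \<in> D \<Longrightarrow> E x \<in> borel_measurable M"
  by (simp add: independent_replicate_def)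

text \<open>Finite linear combinations are measurable for the sigma-algebras generated by their
  families, so they inherit the independence of these.\<close>

lemma replicate_indep:
  assumes rep: "independent_replicate M D E R I Z"
    and Z: "\<And>i. i \<in> I \<Longrightarrow> Z i \<in> borel_measurable M"
    and U: "U \<in> lin_combs I Z" and V: "V \<in> lin_combs D E"
  shows "indep_var borel V borel U"
proof (rule indep_var_subalgebra)
  show "indep_set (sets (generated_sigma M D E)) (sets (generated_sigma M I Z))"
    using rep by (simp add: independent_replicate_def)
qed (use assms in \<open>auto intro!: subalgebra_generated_sigma lin_combs_measurable_generated_sigma
      replicate_measurable[OF rep]\<close>)

text \<open>Pushing the common law of the paths forward along \<open>f\<close> transfers any real
  functional of the path; moments, products and linear combinations are all obtained in this
  way.\<close>

lemma replicate_distr: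
  assumes rep: "independent_replicate M D E R I Z"
    and R: "\<And>x. x \<in> D \<Longrightarrow> R x \<in> borel_measurable M"
    and f: "f \<in> borel_measurable (PiM D (\<lambda>_. borel))"
  shows "distr M borel (\<lambda>\<omega>. f (path D E \<omega>)) = distr M borel (\<lambda>\<omega>. f (path D R \<omega>))"
proof -
  have path: "path D T \<in> measurable M (PiM D (\<lambda>_. borel))"
    if "\<And>x. x \<in> D \<Longrightarrow> T x \<in> borel_measurable M" for T
    unfolding path_def[abs_def] using that by measurable
  have "distr (distr M (PiM D (\<lambda>_. borel)) (path D E)) borel f =
      distr (distr M (PiM D (\<lambda>_. borel)) (path D R)) borel f"
    using rep by (simp add: independent_replicate_def)
  then show ?thesis
    by (subst (asm) (1 2) distr_distr)
       (use f R in \<open>auto simp: comp_def intro!: path replicate_measurable[OF rep]\<close>)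
qed

lemma replicate_integral:
  fixes f :: "_ \<Rightarrow> real"
  assumes rep: "independent_replicate M D E R I Z"
    and R: "\<And>x. x \<in> D \<Longrightarrow> R x \<in> borel_measurable M"
    and f: "f \<in> borel_measurable (PiM D (\<lambda>_. borel))"
  shows "(\<integral>\<omega>. f (path D E \<omega>) \<partial>M) = (\<integral>\<omega>. f (path D R \<omega>) \<partial>M)"
    and "integrable M (\<lambda>\<omega>. f (path D E \<omega>)) \<longleftrightarrow> integrable M (\<lambda>\<omega>. f (path D R \<omega>))"
proof -
  have path[measurable]: "path D E \<in> measurable M (PiM D (\<lambda>_. borel))" "path D R \<in> measurable M (PiM D (\<lambda>_. borel))"
    unfolding path_def[abs_def] using R replicate_measurable[OF rep] by measurable
  note [measurable] = f
  show "(\<integral>\<omega>. f (path D E \<omega>) \<partial>M) = (\<integral>\<omega>. f (path D R \<omega>) \<partial>M)"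
    \<comment> \<open>Both integrals are the mean of the identity under the law of \<open>f\<close>
      applied to the path.\<close>
    using arg_cong[OF replicate_distr[OF assms], where f = "\<lambda>N. integral\<^sup>L N (\<lambda>x. x)"]
    by (simp add: integral_distr)
  show "integrable M (\<lambda>\<omega>. f (path D E \<omega>)) \<longleftrightarrow> integrable M (\<lambda>\<omega>. f (path D R \<omega>))"
    using arg_cong[OF replicate_distr[OF assms], where f = "\<lambda>N. integrable N (\<lambda>x. x)"]
    by (simp add: integrable_distr_eq)
qed

lemma replicate_centered_L2:
  assumes rep: "independent_replicate M D E R I Z"
    and R: "\<And>x. x \<in> D \<Longrightarrow> R x \<in> centered_L2 M" and x: "x \<in> D"
  shows "E x \<in> centered_L2 M"
proof -
  note R' = centered_L2_measurable[OF R]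
  have "(\<lambda>p. p x :: real) \<in> borel_measurable (PiM D (\<lambda>_. borel))"
      "(\<lambda>p. (p x :: real)\<^sup>2) \<in> borel_measurable (PiM D (\<lambda>_. borel))"
    using x by measurable
  from replicate_integral(1)[OF rep R' this(1)] replicate_integral(2)[OF rep R' this(2)]
  show ?thesis
    using R[OF x] x replicate_measurable[OF rep x] by (simp add: centered_L2_def path_def)
qed

lemma replicate_integral_mult:
  assumes rep: "independent_replicate M D E R I Z"
    and R: "\<And>x. x \<in> D \<Longrightarrow> R x \<in> borel_measurable M" and x: "x \<in> D" "y \<in> D"
  shows "(\<integral>\<omega>. E x \<omega> * E y \<omega> \<partial>M) = (\<integral>\<omega>. R x \<omega> * R y \<omega> \<partial>M)"
proof -
  have "(\<lambda>p. p x * p y :: real) \<in> borel_measurable (PiM D (\<lambda>_. borel))"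
    using x by measurable
  from replicate_integral(1)[OF rep R this] x show ?thesis
    by (simp add: path_def)
qed

text \<open>Each finite linear combination is a measurable functional of the path, hence has the
  same law for \<open>E\<close> as for \<open>R\<close>, and Gaussianity depends on the law
  alone.\<close>

lemma replicate_gaussian:
  assumes rep: "independent_replicate M D E R I Z"
    and R: "gaussian_process M D R"
    and R_meas: "\<And>x. x \<in> D \<Longrightarrow> R x \<in> borel_measurable M"
  shows "gaussian_process M D E"
  unfolding gaussian_process_def
proof (intro allI impI, elim conjE)
  fix S and a :: "_ \<Rightarrow> real" assume S: "finite S" "S \<subseteq> D"
  have sum_path: "(\<Sum>x\<in>S. a x * path D T \<omega> x) = (\<Sum>x\<in>S. a x * T x \<omega>)" for T \<omega>
    using S by (intro sum.cong) (auto simp: path_def)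
  have "(\<lambda>p. \<Sum>x\<in>S. a x * p x) \<in> borel_measurable (PiM D (\<lambda>_. borel))"
    using S by (intro borel_measurable_sum borel_measurable_times measurable_component_singleton) auto
  from replicate_distr[OF rep R_meas this]
  show "gaussian_rv M (\<lambda>\<omega>. \<Sum>x\<in>S. a x * E x \<omega>)"
    unfolding sum_path
  proof (rule gaussian_rv_distr_eq[rotated 2])
    show "gaussian_rv M (\<lambda>\<omega>. \<Sum>x\<in>S. a x * R x \<omega>)"
      using R S by (simp add: gaussian_process_def)
    show "(\<lambda>\<omega>. \<Sum>x\<in>S. a x * E x \<omega>) \<in> borel_measurable M"
      using S replicate_measurable[OF rep] by (intro borel_measurable_sum borel_measurable_times) auto
  qed
qed

end

section \<open>Inverses of symmetric matrices\<close>

lemma matrix_inv_cancel: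
  fixes K :: "real^'n^'n"
  assumes "invertible K"
  shows "K *v (matrix_inv K *v u) = u" "matrix_inv K *v (K *v u) = u"
proof -
  have "K ** matrix_inv K = mat 1 \<and> matrix_inv K ** K = mat 1"
    using assms unfolding invertible_def matrix_inv_def by (rule someI_ex)
  then show "K *v (matrix_inv K *v u) = u" "matrix_inv K *v (K *v u) = u"
    by (simp_all add: matrix_vector_mul_assoc)
qed

lemma symmetric_matrix_inner:
  fixes K :: "real^'n^'n"
  assumes "transpose K = K"
  shows "(K *v u) \<bullet> v = u \<bullet> (K *v v)"
  using assms by (metis dot_lmul_matrix transpose_matrix_vector)

text \<open>The symmetry of \<open>K\<close> is applied to the two solved vectors
  \<open>matrix_inv K *v u\<close> and \<open>matrix_inv K *v v\<close>, where \<open>K\<close>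
  cancels its inverse.\<close>

lemma symmetric_matrix_inv_inner:
  fixes K :: "real^'n^'n"
  assumes "invertible K" "transpose K = K"
  shows "(matrix_inv K *v u) \<bullet> v = u \<bullet> (matrix_inv K *v v)"
  using symmetric_matrix_inner[OF assms(2), of "matrix_inv K *v u" "matrix_inv K *v v"]
  by (simp add: matrix_inv_cancel[OF assms(1)])

section \<open>The aggregated process\<close>

text \<open>Collects the assumptions shared by all three claims; invertibility of the Gram matrix,
  linearity and interpolation are stated in the lemmas that use them.\<close>

locale kriging_model = prob_space P for P :: "'w measure" +
  fixes D :: "'x set"
    and M :: "'x \<Rightarrow> 'w \<Rightarrow> real^'p"
    and Y \<epsilon> :: "'x \<Rightarrow> 'w \<Rightarrow> real"
  assumes L2: "centered_square_integrable P (D \<times> UNIV) (joint_process M Y)"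
    and invertible_KM: "\<And>x. x \<in> D \<Longrightarrow> invertible (cov_matrix P M x x)"
    and rep: "independent_replicate P D \<epsilon> (\<lambda>x \<omega>. Y x \<omega> - nested_kriging P M Y x \<omega>)
      (D \<times> UNIV) (joint_process M Y)"
    and gauss: "gaussian_process P (D \<times> UNIV) (joint_process M Y)"
begin

abbreviation "J \<equiv> joint_process M Y"
abbreviation "I \<equiv> D \<times> (UNIV :: 'p option set)"
abbreviation "MA \<equiv> nested_kriging P M Y"
abbreviation "YA \<equiv> aggregated P M Y \<epsilon>"
abbreviation "\<alpha> \<equiv> agg_weights P M Y"
abbreviation "R x \<omega> \<equiv> Y x \<omega> - MA x \<omega>"

lemmas L2' = lin_combs_centered_L2[OF L2]

lemma Y_lin: "x \<in> D \<Longrightarrow> Y x \<in> lin_combs I J"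
  using lin_combs_base[of "(x, None)" I J] by (simp add: joint_process_def)

lemma M_lin: "x \<in> D \<Longrightarrow> (\<lambda>\<omega>. M x \<omega> $ i) \<in> lin_combs I J"
  using lin_combs_base[of "(x, Some i)" I J] by (simp add: joint_process_def)

text \<open>The symmetry of \<open>cov_matrix P M x x\<close> moves its inverse from
  \<open>M x\<close> to the cross-covariance. This shows the predictor as a combination of the
  \<open>M x \<omega> $ i\<close> with deterministic weights, so it lies in the span of the joint
  process.\<close>

lemma nested_kriging_eq:
  assumes "x \<in> D"
  shows "MA x = (\<lambda>\<omega>. \<Sum>i\<in>UNIV. \<alpha> x $ i * M x \<omega> $ i)"
proof -
  have "transpose (cov_matrix P M x x) = cov_matrix P M x x"
    by (simp add: cov_matrix_def transpose_def covariance_def vec_eq_iff mult.commute)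
  from symmetric_matrix_inv_inner[OF invertible_KM[OF assms] this]
  show ?thesis
    by (simp add: fun_eq_iff nested_kriging_def agg_weights_def inner_vec_def)
qed

lemma MA_lin: "x \<in> D \<Longrightarrow> MA x \<in> lin_combs I J"
  by (simp add: nested_kriging_eq lin_combs_sum M_lin)

lemma R_lin: "x \<in> D \<Longrightarrow> R x \<in> lin_combs I J"
  by (intro lin_combs_diff Y_lin MA_lin)

lemma \<epsilon>_L2: "x \<in> D \<Longrightarrow> \<epsilon> x \<in> centered_L2 P"
  by (rule replicate_centered_L2[OF rep]) (auto intro: L2' R_lin)

lemma J_measurable: "i \<in> I \<Longrightarrow> J i \<in> borel_measurable P"
  using L2 by (auto simp: centered_square_integrable_def)

lemma YA_L2: "x \<in> D \<Longrightarrow> YA x \<in> centered_L2 P"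
  unfolding aggregated_def[abs_def] by (intro centered_L2_add \<epsilon>_L2 L2' MA_lin)

text \<open>A linear combination of \<open>YA\<close> splits into one of \<open>MA\<close>, in the
  span of the joint process, and one of \<open>\<epsilon>\<close>, Gaussian because it has the law
  of a combination of prediction errors. The two are independent, so their sum is Gaussian.\<close>

lemma gaussian_YA: "gaussian_process P D YA"
  unfolding gaussian_process_def
proof (intro allI impI, elim conjE)
  fix S and a :: "'x \<Rightarrow> real" assume S: "finite S" "S \<subseteq> D"
  have "gaussian_process P D R"
    unfolding gaussian_process_def
  proof (intro allI impI, elim conjE)
    fix S and a :: "'x \<Rightarrow> real" assume "finite S" "S \<subseteq> D"
    then show "gaussian_rv P (\<lambda>\<omega>. \<Sum>x\<in>S. a x * R x \<omega>)"
      by (intro gaussian_rv_lin_comb[OF gauss] lin_combs_sum R_lin) auto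
  qed
  then have "gaussian_process P D \<epsilon>"
    by (rule replicate_gaussian[OF rep]) (auto intro: centered_L2_measurable L2' R_lin)
  then have 1: "gaussian_rv P (\<lambda>\<omega>. \<Sum>x\<in>S. a x * \<epsilon> x \<omega>)"
    using S by (simp add: gaussian_process_def)
  have MA: "(\<lambda>\<omega>. \<Sum>x\<in>S. a x * MA x \<omega>) \<in> lin_combs I J"
    using S by (intro lin_combs_sum MA_lin) auto
  have "(\<lambda>\<omega>. \<Sum>x\<in>S. a x * \<epsilon> x \<omega>) \<in> lin_combs D \<epsilon>"
    using S by (intro lin_combs_sum lin_combs_base) auto
  from gaussian_rv_add_indep[OF 1 gaussian_rv_lin_comb[OF gauss MA] replicate_indep[OF rep J_measurable MA this]]
  show "gaussian_rv P (\<lambda>\<omega>. \<Sum>x\<in>S. a x * YA x \<omega>)"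
    by (simp add: aggregated_def sum.distrib distrib_left add.commute)
qed

text \<open>The cross terms vanish because \<open>\<epsilon>\<close> is centered and independent of
  the joint process, while the replicate has the covariances of the prediction errors
  themselves.\<close>

lemma cov_YA:
  assumes x: "x \<in> D" "y \<in> D"
  shows "cov_fun P YA x y = (\<integral>\<omega>. MA x \<omega> * MA y \<omega> \<partial>P) + (\<integral>\<omega>. R x \<omega> * R y \<omega> \<partial>P)"
proof -
  note L = L2'[OF MA_lin] \<epsilon>_L2
  have cross: "(\<integral>\<omega>. \<epsilon> u \<omega> * MA v \<omega> \<partial>P) = 0" if "u \<in> D" "v \<in> D" for u v
  proof -
    have "indep_var borel (\<epsilon> u) borel (MA v)"
      using that by (intro replicate_indep[OF rep J_measurable] MA_lin lin_combs_base)
    from indep_var_lebesgue_integral[OF this] L that show ?thesis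
      by (simp add: centered_L2_integrable) (simp add: centered_L2_def)
  qed
  have "cov_fun P YA x y = (\<integral>\<omega>. YA x \<omega> * YA y \<omega> \<partial>P)"
    unfolding cov_fun_def using x by (intro covariance_centered YA_L2)
  also have "\<dots> = (\<integral>\<omega>. MA x \<omega> * MA y \<omega> + \<epsilon> y \<omega> * MA x \<omega> + \<epsilon> x \<omega> * MA y \<omega> + \<epsilon> x \<omega> * \<epsilon> y \<omega> \<partial>P)"
    by (simp add: aggregated_def algebra_simps)
  also have "\<dots> = (\<integral>\<omega>. MA x \<omega> * MA y \<omega> \<partial>P) + (\<integral>\<omega>. \<epsilon> x \<omega> * \<epsilon> y \<omega> \<partial>P)"
    using L x cross by (simp add: integrable_mult_L2)
  also have "(\<integral>\<omega>. \<epsilon> x \<omega> * \<epsilon> y \<omega> \<partial>P) = (\<integral>\<omega>. R x \<omega> * R y \<omega> \<partial>P)"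
    using x by (intro replicate_integral_mult[OF rep] centered_L2_measurable L2' R_lin)
  finally show ?thesis .
qed

section \<open>Conditional covariance of the aggregated process\<close>

lemma cov_fun_commute: "cov_fun P Z x y = cov_fun P Z y x"
  by (simp add: cov_fun_def covariance_def mult.commute)

lemma gram_symmetric: "transpose (gram (cov_fun P Z) X) = gram (cov_fun P Z) X"
  by (simp add: gram_def transpose_def vec_eq_iff cov_fun_commute)

text \<open>Gaussian conditioning is applied to \<open>YA\<close> as a Gaussian family in its own
  right, observed at the points of \<open>X\<close>; invertibility of its Gram matrix provides the
  solution of the normal equations.\<close>

lemma cond_cov_YA:
  fixes X :: "'x^'n"
  assumes X: "\<And>i. X $ i \<in> D" and inv: "invertible (gram (cov_fun P YA) X)"
    and x: "x \<in> D" "y \<in> D"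
  shows "AE \<omega> in P. cond_cov_fun P YA X x y \<omega> = cov_fun P YA x y -
    row_at (cov_fun P YA) x X \<bullet> (matrix_inv (gram (cov_fun P YA) X) *v col_at (cov_fun P YA) X y)"
proof -
  let ?k = "cov_fun P YA"
  let ?K = "gram ?k X"
  \<comment> \<open>The regression weights for predicting \<open>YA z\<close> from the
    observations.\<close>
  define a where "a z = matrix_inv ?K *v row_at ?k z X" for z
  have L2_YA: "centered_square_integrable P D YA"
    by (simp add: centered_L2_iff YA_L2)
  have k_eq: "?k u v = (\<integral>\<omega>. YA u \<omega> * YA v \<omega> \<partial>P)" if "u \<in> D" "v \<in> D" for u v
    unfolding cov_fun_def using that by (intro covariance_centered YA_L2)
  have normal: "(\<integral>\<omega>. YA z \<omega> * YA (X $ i) \<omega> \<partial>P) =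
      (\<Sum>j\<in>UNIV. a z $ j * (\<integral>\<omega>. YA (X $ i) \<omega> * YA (X $ j) \<omega> \<partial>P))" if "z \<in> D" for z i
  proof -
    have "?K *v a z = row_at ?k z X"
      unfolding a_def by (rule matrix_inv_cancel[OF inv])
    then have "(?K *v a z) $ i = row_at ?k z X $ i" by simp
    then show ?thesis
      using X that by (simp add: matrix_vector_mult_def gram_def row_at_def k_eq mult.commute)
  qed
  have "AE \<omega> in P. cond_cov_fun P YA X x y \<omega> =
      (\<integral>\<omega>. YA x \<omega> * YA y \<omega> \<partial>P) - (\<Sum>j\<in>UNIV. a x $ j * (\<integral>\<omega>. YA y \<omega> * YA (X $ j) \<omega> \<partial>P))"
    unfolding cond_cov_fun_def
    by (rule gaussian_cond_covariance[OF gaussian_YA L2_YA, where b = "\<lambda>j. a y $ j"])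
       (use x X normal in \<open>auto intro: lin_combs_base\<close>)
  moreover have "(\<Sum>j\<in>UNIV. a x $ j * (\<integral>\<omega>. YA y \<omega> * YA (X $ j) \<omega> \<partial>P)) = a x \<bullet> col_at ?k X y"
    using x X by (simp add: inner_vec_def col_at_def cov_fun_commute[of _ _ y] k_eq)
  moreover have "a x \<bullet> col_at ?k X y = row_at ?k x X \<bullet> (matrix_inv ?K *v col_at ?k X y)"
    unfolding a_def by (rule symmetric_matrix_inv_inner[OF inv gram_symmetric])
  ultimately show ?thesis using x by (simp add: k_eq)
qed

text \<open>This links (iii) to (ii): bilinear expansion of the error covariance, with the predictor
  written through its weights \<open>\<alpha>\<close>.\<close>

lemma cov_residual:
  assumes x: "x \<in> D" "y \<in> D"
  shows "(\<integral>\<omega>. R x \<omega> * R y \<omega> \<partial>P) = cov_fun P Y x y - \<alpha> x \<bullet> cross_cov P M Y x y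
    - cross_cov P M Y y x \<bullet> \<alpha> y + \<alpha> x \<bullet> (cov_matrix P M x y *v \<alpha> y)"
proof -
  note L = L2'[OF MA_lin] L2'[OF Y_lin] L2'[OF M_lin]
  have MA_sum: "(\<integral>\<omega>. U \<omega> * MA z \<omega> \<partial>P) = (\<Sum>i\<in>UNIV. \<alpha> z $ i * (\<integral>\<omega>. U \<omega> * M z \<omega> $ i \<partial>P))"
    if "U \<in> centered_L2 P" "z \<in> D" for U z
    unfolding nested_kriging_eq[OF that(2)] using that L by (intro integral_mult_sum_L2)
  have "(\<integral>\<omega>. R x \<omega> * R y \<omega> \<partial>P) =
      (\<integral>\<omega>. Y x \<omega> * Y y \<omega> - Y y \<omega> * MA x \<omega> - Y x \<omega> * MA y \<omega> + MA y \<omega> * MA x \<omega> \<partial>P)"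
    by (simp add: algebra_simps)
  also have "\<dots> = (\<integral>\<omega>. Y x \<omega> * Y y \<omega> \<partial>P) - (\<integral>\<omega>. Y y \<omega> * MA x \<omega> \<partial>P)
      - (\<integral>\<omega>. Y x \<omega> * MA y \<omega> \<partial>P) + (\<integral>\<omega>. MA y \<omega> * MA x \<omega> \<partial>P)"
    using L x by (simp add: integrable_mult_L2)
  also have "(\<integral>\<omega>. Y x \<omega> * Y y \<omega> \<partial>P) = cov_fun P Y x y"
    unfolding cov_fun_def using L x by (simp add: covariance_centered)
  also have "(\<integral>\<omega>. Y y \<omega> * MA x \<omega> \<partial>P) = \<alpha> x \<bullet> cross_cov P M Y x y"
    using MA_sum[of "Y y" x] L x
    by (simp add: inner_vec_def cross_cov_def covariance_centered mult.commute)
  also have "(\<integral>\<omega>. Y x \<omega> * MA y \<omega> \<partial>P) = cross_cov P M Y y x \<bullet> \<alpha> y"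
    using MA_sum[of "Y x" y] L x
    by (simp add: inner_vec_def cross_cov_def covariance_centered mult.commute)
  also have "(\<integral>\<omega>. MA y \<omega> * MA x \<omega> \<partial>P) = \<alpha> x \<bullet> (cov_matrix P M x y *v \<alpha> y)"
  proof -
    have "(\<integral>\<omega>. MA y \<omega> * M x \<omega> $ i \<partial>P) = (cov_matrix P M x y *v \<alpha> y) $ i" for i
      using MA_sum[of "\<lambda>\<omega>. M x \<omega> $ i" y] L x
      by (simp add: matrix_vector_mult_def cov_matrix_def covariance_centered mult.commute)
    then show ?thesis
      using MA_sum[of "MA y" x] L x by (simp add: inner_vec_def)
  qed
  finally show ?thesis .
qed

text \<open>If some \<open>M x \<omega> $ i\<close> equals \<open>Y x\<close>, the cross-covariance
  vector is column \<open>i\<close> of the covariance matrix. Solving against that matrix gives the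
  \<open>i\<close>-th unit vector as weights, so the predictor reproduces this component.\<close>

lemma nested_kriging_interpolates:
  assumes x: "x \<in> D" and interp: "AE \<omega> in P. M x \<omega> $ i = Y x \<omega>"
  shows "AE \<omega> in P. MA x \<omega> = Y x \<omega>"
proof -
  have [measurable]: "(\<lambda>\<omega>. M x \<omega> $ j) \<in> borel_measurable P" "Y x \<in> borel_measurable P" for j
    using x by (auto intro: centered_L2_measurable L2' M_lin Y_lin)
  have "cross_cov P M Y x x $ j = (cov_matrix P M x x *v axis i 1) $ j" for j
  proof -
    have "covariance P (\<lambda>\<omega>. M x \<omega> $ j) (Y x) = covariance P (\<lambda>\<omega>. M x \<omega> $ j) (\<lambda>\<omega>. M x \<omega> $ i)"
      using L2'[OF M_lin[OF x]] L2'[OF Y_lin[OF x]] interp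
      by (simp add: covariance_centered) (rule integral_cong_AE; auto)
    then show ?thesis
      by (simp add: cross_cov_def cov_matrix_def matrix_vector_mult_basis column_def)
  qed
  then have "cross_cov P M Y x x = cov_matrix P M x x *v axis i 1"
    by (simp add: vec_eq_iff)
  then have "\<alpha> x = axis i 1"
    by (simp add: agg_weights_def matrix_inv_cancel invertible_KM x)
  then have "MA x \<omega> = M x \<omega> $ i" for \<omega>
    using x by (simp add: nested_kriging_eq axis_def if_distrib[of "\<lambda>c. c * _"] cong: if_cong)
  with interp show ?thesis by simp
qed

text \<open>The regression term of \<open>cond_cov_YA\<close> equals the predictor part of
  \<open>cov_YA\<close>, so subtracting it leaves the error covariance. The point is that
  \<open>MA y\<close> is itself a combination of the observations, whose coefficients cancel the
  inverse Gram matrix.\<close>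

lemma cond_cov_eq_cov_residual:
  fixes X :: "'x^'n"
  assumes X: "\<And>i. X $ i \<in> D" and inv: "invertible (gram (cov_fun P YA) X)"
    and linear: "AE \<omega> in P. M y \<omega> = (\<Lambda> :: real^'n^'p) *v obs Y X \<omega>"
    and interp: "\<And>l. \<exists>i. AE \<omega> in P. M (X $ l) \<omega> $ i = Y (X $ l) \<omega>"
    and x: "x \<in> D" "y \<in> D"
  shows "AE \<omega> in P. cond_cov_fun P YA X x y \<omega> = (\<integral>\<omega>. R x \<omega> * R y \<omega> \<partial>P)"
proof -
  let ?k = "cov_fun P YA"
  note L = L2'[OF MA_lin] L2'[OF Y_lin] L2'[OF R_lin]
  have MA_X: "AE \<omega> in P. MA (X $ l) \<omega> = Y (X $ l) \<omega>" for l
    using interp[of l] nested_kriging_interpolates[OF X] by blast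
  \<comment> \<open>At an observation point the prediction error is almost surely zero, so the
    second term of \<open>cov_YA\<close> disappears, and in the first the predictor may be replaced
    by \<open>Y\<close>.\<close>
  have k_X: "?k u (X $ l) = (\<integral>\<omega>. MA u \<omega> * Y (X $ l) \<omega> \<partial>P)" if u: "u \<in> D" for u l
  proof -
    have [measurable]: "MA u \<in> borel_measurable P" "MA (X $ l) \<in> borel_measurable P" "Y (X $ l) \<in> borel_measurable P"
       "Y u \<in> borel_measurable P"
      using u X L by (auto intro: centered_L2_measurable)
    have "(\<integral>\<omega>. R u \<omega> * R (X $ l) \<omega> \<partial>P) = (\<integral>\<omega>. 0 \<partial>P)"
      by (rule integral_cong_AE) (use MA_X[of l] in auto)
    moreover have "(\<integral>\<omega>. MA u \<omega> * MA (X $ l) \<omega> \<partial>P) = (\<integral>\<omega>. MA u \<omega> * Y (X $ l) \<omega> \<partial>P)"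
      by (rule integral_cong_AE) (use MA_X[of l] in auto)
    ultimately show ?thesis using cov_YA[OF u X] by simp
  qed
  \<comment> \<open>The coefficients of \<open>MA y\<close> on the observations: the aggregation
    weights carried through the linear map \<open>\<Lambda>\<close>.\<close>
  define \<beta> where "\<beta> = \<alpha> y v* \<Lambda>"
  have MA_y: "AE \<omega> in P. MA y \<omega> = (\<Sum>l\<in>UNIV. \<beta> $ l * Y (X $ l) \<omega>)"
    using linear
  proof eventually_elim
    case (elim \<omega>)
    have "MA y \<omega> = \<alpha> y \<bullet> (\<Lambda> *v obs Y X \<omega>)"
      using x elim by (simp add: nested_kriging_eq inner_vec_def)
    also have "\<dots> = \<beta> \<bullet> obs Y X \<omega>"
      by (simp add: \<beta>_def dot_lmul_matrix)
    finally show ?case by (simp add: inner_vec_def obs_def)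
  qed
  have MA_MA_y: "(\<integral>\<omega>. U \<omega> * MA y \<omega> \<partial>P) = (\<Sum>l\<in>UNIV. \<beta> $ l * (\<integral>\<omega>. U \<omega> * Y (X $ l) \<omega> \<partial>P))"
    if U: "U \<in> centered_L2 P" for U
  proof -
    have [measurable]: "U \<in> borel_measurable P" "MA y \<in> borel_measurable P" "\<And>l. Y (X $ l) \<in> borel_measurable P"
      using U L x X by (auto intro: centered_L2_measurable)
    have "(\<integral>\<omega>. U \<omega> * MA y \<omega> \<partial>P) = (\<integral>\<omega>. U \<omega> * (\<Sum>l\<in>UNIV. \<beta> $ l * Y (X $ l) \<omega>) \<partial>P)"
      by (rule integral_cong_AE) (use MA_y in auto)
    then show ?thesis
      using L X U by (simp add: integral_mult_sum_L2)
  qed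
  \<comment> \<open>On the observation points \<open>?k\<close> is the covariance of
    \<open>Y\<close>, so expanding \<open>MA y\<close> along \<open>\<beta>\<close> exhibits
    \<open>\<beta>\<close> as the solution of the linear system in the regression term.\<close>
  have "col_at ?k X y = gram ?k X *v \<beta>"
  proof (rule vec_eq_iff[THEN iffD2, rule_format])
    fix l
    have "(gram ?k X *v \<beta>) $ l = (\<Sum>m\<in>UNIV. \<beta> $ m * (\<integral>\<omega>. Y (X $ l) \<omega> * Y (X $ m) \<omega> \<partial>P))"
    proof -
      have "?k (X $ l) (X $ m) = (\<integral>\<omega>. Y (X $ l) \<omega> * Y (X $ m) \<omega> \<partial>P)" for m
      proof -
        have [measurable]: "\<And>l. MA (X $ l) \<in> borel_measurable P" "\<And>l. Y (X $ l) \<in> borel_measurable P"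
          using L X by (auto intro: centered_L2_measurable)
        show ?thesis
          unfolding k_X[OF X] by (rule integral_cong_AE) (use MA_X[of l] in auto)
      qed
      then show ?thesis by (simp add: matrix_vector_mult_def gram_def mult.commute)
    qed
    also have "\<dots> = (\<integral>\<omega>. Y (X $ l) \<omega> * MA y \<omega> \<partial>P)"
      using MA_MA_y[of "Y (X $ l)"] L X by simp
    also have "\<dots> = ?k y (X $ l)"
      using x by (simp add: k_X mult.commute)
    finally show "col_at ?k X y $ l = (gram ?k X *v \<beta>) $ l"
      by (simp add: col_at_def cov_fun_commute[of _ y])
  qed
  then have "row_at ?k x X \<bullet> (matrix_inv (gram ?k X) *v col_at ?k X y) = row_at ?k x X \<bullet> \<beta>"
    by (simp add: matrix_inv_cancel inv)
  \<comment> \<open>By \<open>k_X\<close> the row holds the covariances of \<open>MA x\<close> with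
    the observations; summed against \<open>\<beta>\<close> they rebuild
    \<open>MA y\<close>.\<close>
  also have "\<dots> = (\<integral>\<omega>. MA x \<omega> * MA y \<omega> \<partial>P)"
    using MA_MA_y[of "MA x"] L x by (simp add: inner_vec_def row_at_def k_X mult.commute)
  finally show ?thesis
    using cond_cov_YA[OF X inv x] cov_YA[OF x] by simp
qed

end

theorem proposition4:
  fixes P :: "'w measure"
    and D :: "(real^'d) set"
    and M :: "real^'d \<Rightarrow> 'w \<Rightarrow> real^'p"
    and Y \<epsilon> :: "real^'d \<Rightarrow> 'w \<Rightarrow> real"
    and X :: "(real^'d)^'n"
  defines "k \<equiv> cov_fun P Y"
    and "kM \<equiv> cross_cov P M Y"
    and "KM \<equiv> cov_matrix P M"
    and "MA \<equiv> nested_kriging P M Y"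
    and "YA \<equiv> aggregated P M Y \<epsilon>"
    and "kA \<equiv> cov_fun P (aggregated P M Y \<epsilon>)"
    and "cA \<equiv> cond_cov_fun P (aggregated P M Y \<epsilon>) X"
    and "\<alpha> \<equiv> agg_weights P M Y"
  assumes "prob_space P"
    and "centered_square_integrable P (D \<times> UNIV) (joint_process M Y)"
    and "\<And>x. x \<in> D \<Longrightarrow> invertible (KM x x)"
    and "\<And>i. X $ i \<in> D"
    and "independent_replicate P D \<epsilon> (\<lambda>x \<omega>. Y x \<omega> - MA x \<omega>) (D \<times> UNIV) (joint_process M Y)"
    and "invertible (gram k X)"
    and "invertible (gram kA X)"
    and "gaussian_process P (D \<times> UNIV) (joint_process M Y)"
  shows "gaussian_process P D YA \<and>
    (\<forall>x\<in>D. \<forall>x'\<in>D. AE \<omega> in P. cA x x' \<omega> =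
       kA x x' - row_at kA x X \<bullet> (matrix_inv (gram kA X) *v col_at kA X x')) \<and>
    ((\<forall>x\<in>D. \<exists>\<Lambda> :: real^'n^'p. AE \<omega> in P. M x \<omega> = \<Lambda> *v obs Y X \<omega>) \<and>
     (\<forall>l. \<exists>i. AE \<omega> in P. M (X $ l) \<omega> $ i = Y (X $ l) \<omega>) \<longrightarrow>
       (\<forall>x\<in>D. \<forall>x'\<in>D. AE \<omega> in P. cA x x' \<omega> =
          k x x' - \<alpha> x \<bullet> kM x x' - kM x' x \<bullet> \<alpha> x' + \<alpha> x \<bullet> (KM x x' *v \<alpha> x')) \<and>
       (\<forall>x\<in>D. \<forall>x'\<in>D. AE \<omega> in P. cA x x' \<omega> =
          integral\<^sup>L P (\<lambda>\<omega>. (Y x \<omega> - MA x \<omega>) * (Y x' \<omega> - MA x' \<omega>))))"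
proof -
  interpret kriging_model P D M Y \<epsilon>
    using assms(9-11,13,16) unfolding kriging_model_def kriging_model_axioms_def KM_def MA_def by blast
  have X: "\<And>i. X $ i \<in> D" and inv: "invertible (gram (cov_fun P (aggregated P M Y \<epsilon>)) X)"
    using assms(12,15) by (auto simp: kA_def)
  have i: "\<forall>x\<in>D. \<forall>x'\<in>D. AE \<omega> in P. cA x x' \<omega> =
      kA x x' - row_at kA x X \<bullet> (matrix_inv (gram kA X) *v col_at kA X x')"
    unfolding cA_def kA_def using cond_cov_YA[OF X inv] by blast
  have iii: "AE \<omega> in P. cA x x' \<omega> = (\<integral>\<omega>. (Y x \<omega> - MA x \<omega>) * (Y x' \<omega> - MA x' \<omega>) \<partial>P)"
    if "\<forall>x\<in>D. \<exists>\<Lambda> :: real^'n^'p. AE \<omega> in P. M x \<omega> = \<Lambda> *v obs Y X \<omega>"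
      and "\<forall>l. \<exists>i. AE \<omega> in P. M (X $ l) \<omega> $ i = Y (X $ l) \<omega>"
      and x: "x \<in> D" "x' \<in> D" for x x'
  proof -
    from that(1) x(2) obtain \<Lambda> :: "real^'n^'p" where "AE \<omega> in P. M x' \<omega> = \<Lambda> *v obs Y X \<omega>"
      by blast
    from cond_cov_eq_cov_residual[OF X inv this _ x] that(2) show ?thesis
      unfolding cA_def MA_def by blast
  qed
  \<comment> \<open>The right-hand sides of (ii) and (iii) agree as numbers, so (ii) follows from
    (iii) by rewriting.\<close>
  have ii: "(\<integral>\<omega>. (Y x \<omega> - MA x \<omega>) * (Y x' \<omega> - MA x' \<omega>) \<partial>P) =
      k x x' - \<alpha> x \<bullet> kM x x' - kM x' x \<bullet> \<alpha> x' + \<alpha> x \<bullet> (KM x x' *v \<alpha> x')"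
    if "x \<in> D" "x' \<in> D" for x x'
    unfolding MA_def k_def \<alpha>_def kM_def KM_def by (rule cov_residual[OF that])
  from gaussian_YA have "gaussian_process P D YA"
    by (simp add: YA_def)
  with i iii show ?thesis
    by (simp add: ii)
qed

end
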